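(* For each fixed integer $N\ge2$ and each fixed real $q>1/2$, $$\lim_{a\downarrow0}\frac{H_N(F_{a,q})}{\ell_a}=\frac{N-1}{2},\qquad \lim_{a\downarrow0}\frac{\mathcal D_N(F_{a,q},\log F_{a,q})}{\ell_a}=2q,$$ where $\ell_a=\log(1/a)$ and, for $0<a<1$, $F_{a,q}$ is the probability density on $S^{N-1}(\sqrt N)$ proportional to $\prod_{i=1}^N(a+v_i^2)^{-q}$.
   Context: Let $\mathbb S_N=S^{N-1}(\sqrt N)=\{v\in\mathbb R^N:\sum_{i=1}^N v_i^2=N\}$ and let $\sigma_N$ be the uniform probability measure on $\mathbb S_N$. For $1\le i<j\le N$ and $\theta\in[0,2\pi)$, $R_{ij,\theta}$ is the rotation $(v_i,v_j)\mapsto(v_i\cos\theta-v_j\sin\theta,\ v_i\sin\theta+v_j\cos\theta)$ leaving all other coordinates unchanged. For a probability density $F$ with respect to $\sigma_N$, $H_N(F)=\int_{\mathbb S_N}F\log F\,d\sigma_N$, and for strictly positive $F$ $$\mathcal D_N(F,\log F)=\frac1{N-1}\sum_{1\le i<j\le N}\int_{\mathbb S_N}\int_0^{2\pi}\bigl(F(v)-F(R_{ij,\theta}v)\bigr)\bigl(\log F(v)-\log F(R_{ij,\theta}v)\bigr)\frac{d\theta}{2\pi}\,d\sigma_N(v).$$ For $0<a<1$ and $q>1/2$: $$G_{a,q}(v)=\prod_{i=1}^N(a+v_i^2)^{-q},\qquad Z_{a,q}=\int_{\mathbb S_N}G_{a,q}\,d\sigma_N,\qquad F_{a,q}=\frac{G_{a,q}}{Z_{a,q}}.$$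 *)

theory Defs
  imports "HOL-Probability.Probability"
begin

text \<open>
  The dimension \<open>N\<close> is \<open>CARD('n)\<close>, and the coordinates are indexed by a finite linearly ordered
  type \<open>'n\<close>, so that sums over pairs \<open>i < j\<close> make sense. For finite types the class
  \<open>wellorder\<close>, which the library's change-of-variables theorems ask for, amounts to \<open>linorder\<close>.
\<close>

definition sphereN :: "(real ^ 'n) set" where
  "sphereN = sphere 0 (sqrt (real CARD('n)))"

text \<open>
  The uniform probability measure is the normalised cone measure: the law of
  \<open>sqrt N * x / norm x\<close> for \<open>x\<close> uniform in the unit ball. It is a Borel measure on the ambient
  space carried by the sphere, so integrals over the sphere are integrals with respect to it.
  The lemmas below show that it is a probability measure, that it gives the sphere full mass
  and that it is invariant under orthogonal maps.
\<close>

definition sphere_proj :: "real ^ 'n \<Rightarrow> real ^ 'n" where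
  "sphere_proj x = (sqrt (real CARD('n)) / norm x) *\<^sub>R x"

definition sigmaN :: "(real ^ 'n) measure" where
  "sigmaN = distr (uniform_measure lborel (ball 0 1)) borel sphere_proj"

definition rot :: "'n \<Rightarrow> 'n \<Rightarrow> real \<Rightarrow> real ^ 'n \<Rightarrow> real ^ 'n" where
  "rot i j \<theta> v = (\<chi> k. if k = i then v $ i * cos \<theta> - v $ j * sin \<theta>
                       else if k = j then v $ i * sin \<theta> + v $ j * cos \<theta>
                       else v $ k)"

definition entropyN :: "(real ^ 'n \<Rightarrow> real) \<Rightarrow> real" where
  "entropyN F = (LINT v|sigmaN. (F v * ln (F v)))"

text \<open>\<open>dissipationN F\<close> is \<open>D_N(F, log F)\<close>; it is meaningful for strictly positive \<open>F\<close>.\<close>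

definition dissipationN :: "(real ^ 'n::{finite,wellorder} \<Rightarrow> real) \<Rightarrow> real" where
  "dissipationN F = 1 / (real CARD('n) - 1) *
     (\<Sum>(i, j) | i < j.
        LINT v|sigmaN. (LINT \<theta>:{0..2 * pi}|lborel.
          (F v - F (rot i j \<theta> v)) * (ln (F v) - ln (F (rot i j \<theta> v))) / (2 * pi)))"

definition G_aq :: "real \<Rightarrow> real \<Rightarrow> real ^ 'n \<Rightarrow> real" where
  "G_aq a q v = (\<Prod>i\<in>UNIV. (a + (v $ i)\<^sup>2) powr (- q))"

definition Z_aq :: "'n::finite itself \<Rightarrow> real \<Rightarrow> real \<Rightarrow> real" where
  "Z_aq _ a q = (LINT v|(sigmaN :: (real ^ 'n) measure). G_aq a q v)"

definition F_aq :: "real \<Rightarrow> real \<Rightarrow> real ^ 'n \<Rightarrow> real" where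
  "F_aq a q v = G_aq a q v / Z_aq TYPE('n) a q"

lemma sphere_proj_measurable [measurable]: "sphere_proj \<in> borel_measurable borel"
  unfolding sphere_proj_def by measurable

lemma sets_sigmaN [simp, measurable_cong]: "sets sigmaN = sets borel"
  and space_sigmaN [simp]: "space sigmaN = UNIV"
  by (simp_all add: sigmaN_def)

lemma prob_space_unit_ball:
  "prob_space (uniform_measure lborel (ball (0 :: real ^ 'n) 1))"
proof (rule prob_space_uniform_measure)
  show "emeasure lborel (ball (0 :: real ^ 'n) 1) \<noteq> 0"
    using emeasure_lborel_ball_finite[of "0 :: real ^ 'n" 1] content_ball_pos[of 1 "0 :: real ^ 'n"]
    by (metis less_irrefl measure_def enn2real_0 zero_less_one)
  show "emeasure lborel (ball (0 :: real ^ 'n) 1) \<noteq> \<infinity>"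
    using emeasure_lborel_ball_finite[of "0 :: real ^ 'n" 1] by simp
qed

lemma prob_space_sigmaN: "prob_space (sigmaN :: (real ^ 'n) measure)"
  unfolding sigmaN_def by (intro prob_space.prob_space_distr prob_space_unit_ball) simp

lemma AE_sigmaN_sphereN: "AE v in (sigmaN :: (real ^ 'n) measure). v \<in> sphereN"
proof -
  have "AE x in lborel. x \<noteq> (0 :: real ^ 'n)"
    by (rule AE_lborel_singleton)
  then have "AE x in uniform_measure lborel (ball (0 :: real ^ 'n) 1). x \<noteq> 0"
    by (intro AE_uniform_measureI) auto
  then have "AE x in uniform_measure lborel (ball (0 :: real ^ 'n) 1). sphere_proj x \<in> sphereN"
    by eventually_elim (simp add: sphere_proj_def sphereN_def)
  then show ?thesis
    unfolding sigmaN_def by (subst AE_distr_iff) (auto simp: sphereN_def)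
qed

lemma emeasure_sigmaN_sphereN: "emeasure sigmaN (sphereN :: (real ^ 'n) set) = 1"
  by (rule prob_space.emeasure_eq_1_AE[OF prob_space_sigmaN _ AE_sigmaN_sphereN])
    (simp add: sphereN_def)

lemma distr_sigmaN_orthogonal:
  fixes f :: "real ^ 'n::{finite,wellorder} \<Rightarrow> real ^ 'n::_"
  assumes f: "orthogonal_transformation f"
  shows "distr sigmaN borel f = sigmaN"
proof -
  define B :: "(real ^ 'n::_) set" where "B = ball 0 1"
  have [measurable]: "B \<in> sets borel" by (simp add: B_def)
  have Bfin: "emeasure lborel B < \<infinity>"
    by (simp add: B_def emeasure_lborel_ball_finite del: infinity_ennreal_def)
  let ?U = "uniform_measure lborel B"
  have lin: "linear f" and nrm: "norm (f x) = norm x" for x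
    using f by (auto simp: orthogonal_transformation)
  have [measurable]: "f \<in> borel_measurable borel"
    using lin by (intro borel_measurable_continuous_onI linear_continuous_on)
      (simp add: linear_conv_bounded_linear)
  define g where "g = inv f"
  have g: "orthogonal_transformation g"
    unfolding g_def by (rule orthogonal_transformation_inv[OF f])
  have gf: "g (f x) = x" and fg: "f (g x) = x" for x
    unfolding g_def using orthogonal_transformation_bij[OF f]
    by (simp_all add: bij_is_inj bij_is_surj surj_f_inv_f)
  have gB: "g x \<in> B \<longleftrightarrow> x \<in> B" for x
    by (simp add: B_def orthogonal_transformation_norm[OF g])
  have "distr ?U borel f = ?U"
  proof (rule measure_eqI)
    fix A assume "A \<in> sets (distr ?U borel f)"
    then have A [measurable]: "A \<in> sets borel" by simp
    have fA [measurable]: "f -` A \<in> sets borel"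
      using measurable_sets_borel[of f borel A] by simp
    have fin: "emeasure lborel (C \<inter> B) \<noteq> \<infinity>" for C
    proof -
      have "emeasure lborel (C \<inter> B) \<le> emeasure lborel B"
        by (rule emeasure_mono) auto
      with Bfin show ?thesis by (auto simp: top_unique)
    qed
    have "x \<in> g ` (A \<inter> B)" if "x \<in> f -` A \<inter> B" for x
      using that gB[of "f x"] gf[of x] by (metis IntD1 IntD2 IntI image_eqI vimageD)
    then have vim: "f -` A \<inter> B = g ` (A \<inter> B)"
      using fg gB by auto
    have lm: "A \<inter> B \<in> lmeasurable"
      using fin[of A] by (intro fmeasurableI) (auto simp: less_top)
    have "measure lebesgue (g ` (A \<inter> B)) = measure lebesgue (A \<inter> B)"
      by (rule measure_orthogonal_image[OF g lm])
    then have "measure lborel (f -` A \<inter> B) = measure lborel (A \<inter> B)"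
      by (simp add: vim[symmetric] measure_completion)
    then have "emeasure lborel (f -` A \<inter> B) = emeasure lborel (A \<inter> B)"
      using fin by (simp add: emeasure_eq_ennreal_measure)
    then show "emeasure (distr ?U borel f) A = emeasure ?U A"
      by (simp add: emeasure_distr Int_commute)
  qed simp
  moreover have "f \<circ> sphere_proj = sphere_proj \<circ> f"
    by (auto simp: fun_eq_iff sphere_proj_def nrm linear_cmul[OF lin])
  moreover have "distr (distr ?U borel sphere_proj) borel f = distr ?U borel (f \<circ> sphere_proj)"
    by (rule distr_distr) simp_all
  moreover have "distr (distr ?U borel f) borel sphere_proj = distr ?U borel (sphere_proj \<circ> f)"
    by (rule distr_distr) simp_all
  ultimately show ?thesis
    unfolding sigmaN_def B_def by simp
qed

end

theory Submission
  imports Defs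
begin

text \<open>
  Write \<open>S = logsum a\<close>, so that \<open>G_aq a q = exp (q * S)\<close>, and \<open>l = ln (1/a)\<close>. On the sphere some
  coordinate satisfies \<open>\<bar>v $ k\<bar> \<ge> 1\<close>, hence the defect \<open>U = (N - 1) * l - S\<close> is nonnegative. Since
  \<open>q > 1/2\<close>, the mass of \<open>G_aq a q\<close> sits where the other \<open>N - 1\<close> coordinates have size \<open>sqrt a\<close>, and
  the normalising constant is \<open>exp ((N - 1) * (q - 1/2) * l)\<close> up to constant factors. Comparing the
  constants for two exponents \<open>q' < q\<close> by \<open>c * U \<le> exp (c * U)\<close>, \<open>c = q - q'\<close>, bounds the mean of \<open>U\<close>
  under \<open>F_aq a q\<close> uniformly in \<open>a\<close>; this gives the entropy.

  For the dissipation, invariance of the measure turns each pair term into the mean under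
  \<open>F_aq a q\<close> of \<open>S - S \<circ> rot i j \<theta>\<close> and of the same expression with \<open>- \<theta>\<close>. At a fixed angle with
  \<open>sin \<theta> * cos \<theta> \<noteq> 0\<close> and up to \<open>3 * U + const \<theta>\<close>, this difference is \<open>l\<close> if \<open>k \<in> {i, j}\<close> (the large
  coordinate is spread over two) and \<open>0\<close> otherwise; exactly \<open>N - 1\<close> pairs contain \<open>k\<close>. Dominated
  convergence in \<open>\<theta>\<close> avoids any integrability argument for \<open>const \<theta>\<close>.
\<close>

section \<open>Product integrals over R^N and the one-dimensional mass of the weight\<close>

lemma nn_integral_lborel_prod_cart:
  fixes f :: "'n::finite \<Rightarrow> real \<Rightarrow> ennreal"
  assumes [measurable]: "\<And>i. f i \<in> borel_measurable borel"
  shows "(\<integral>\<^sup>+x. (\<Prod>i\<in>UNIV. f i (x $ i)) \<partial>lborel) = (\<Prod>i\<in>UNIV. (\<integral>\<^sup>+t. f i t \<partial>lborel))"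
proof -
  \<comment> \<open>The product formula \<open>nn_integral_lborel_prod\<close> indexes its factors
    by basis vectors; the description operator recovers the coordinate \<open>i\<close> from
    \<open>axis i 1\<close>.\<close>
  let ?g = "\<lambda>b::real^'n. f (THE i. b = axis i 1)"
  have the: "(THE i'. axis i (1::real) = axis i' 1) = i" for i :: 'n
    by (auto simp: axis_eq_axis)
  have inj: "inj (\<lambda>i::'n. axis i (1::real))"
    by (auto simp: inj_on_def axis_eq_axis)
  have basis: "(Basis :: (real^'n) set) = range (\<lambda>i. axis i 1)"
    by (auto simp: Basis_vec_def)
  have red: "prod h Basis = (\<Prod>i\<in>UNIV. h (axis i 1))" for h :: "real^'n \<Rightarrow> ennreal"
    unfolding basis using inj by (simp add: prod.reindex)
  have "(\<integral>\<^sup>+x. (\<Prod>b\<in>Basis. ?g b ((x::real^'n) \<bullet> b)) \<partial>lborel) = (\<Prod>b\<in>Basis. (\<integral>\<^sup>+t. ?g b t \<partial>lborel))"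
    by (rule nn_integral_lborel_prod) auto
  then show ?thesis
    by (simp add: red the inner_axis)
qed

text \<open>Since \<open>(sqrt a + t)\<^sup>2 \<le> 2 * (a + t\<^sup>2)\<close>, the weight is
  dominated by a pure power of \<open>sqrt a + t\<close>, which has an elementary
  antiderivative.\<close>

lemma powr_neg_le_shifted:
  fixes a q t :: real
  assumes "a > 0" "q > 0" "t \<ge> 0"
  shows "(a + t\<^sup>2) powr (-q) \<le> 2 powr q * (sqrt a + t) powr (-(2*q))"
proof -
  have "(sqrt a + t)\<^sup>2 \<le> 2 * (a + t\<^sup>2)"
  proof -
    have "0 \<le> (sqrt a - t)\<^sup>2" by simp
    then show ?thesis using assms by (simp add: power2_sum power2_diff)
  qed
  then have "(a + t\<^sup>2) powr (-q) \<le> ((sqrt a + t)\<^sup>2 / 2) powr (-q)"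
    using assms by (intro powr_mono2') (auto simp: add_pos_nonneg less_imp_neq[symmetric])
  also have "\<dots> = 2 powr q * (sqrt a + t) powr (-(2*q))"
  proof -
    have "sqrt a + t > 0" using assms by (auto intro!: add_pos_nonneg)
    then have "((sqrt a + t)\<^sup>2) powr (-q) = (sqrt a + t) powr (-(2*q))"
      by (simp add: powr_powr flip: powr_numeral)
    then show ?thesis
      by (simp add: powr_divide powr_minus field_simps)
  qed
  finally show ?thesis .
qed

text \<open>The mass sits at the scale \<open>t\<close> about \<open>sqrt a\<close>, where the
  integrand is about \<open>a powr (-q)\<close>; this explains the power \<open>1/2 - q\<close>. The
  hypothesis on \<open>q\<close> gives convergence at infinity.\<close>

lemma nn_integral_powr_neg_le:
  fixes a q :: real
  assumes a: "a > 0" and q: "q > 1/2"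
  shows "(\<integral>\<^sup>+t. ennreal ((a + t\<^sup>2) powr (-q)) \<partial>lborel)
    \<le> ennreal (2 * (2 powr q / (2*q - 1)) * a powr (1/2 - q))"
proof -
  define f where "f t = 2 powr q * (sqrt a + t) powr (-(2*q))" for t
  \<comment> \<open>An antiderivative of \<open>f\<close>. The exponent \<open>1 - 2*q\<close> is
    negative, so \<open>F\<close> vanishes at infinity and the half-line integral is
    \<open>- F 0\<close>.\<close>
  define F where "F t = 2 powr q * ((sqrt a + t) powr (1 - 2*q) / (1 - 2*q))" for t
  have [measurable]: "f \<in> borel_measurable borel" unfolding f_def by measurable
  have sa: "sqrt a > 0" using a by simp
  have "(\<integral>\<^sup>+t. ennreal (f t) * indicator {0..} t \<partial>lborel) = ennreal (0 - F 0)"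
  proof (rule nn_integral_FTC_atLeast)
    show "DERIV F t :> f t" if "0 \<le> t" for t
    proof -
      have "sqrt a + t > 0" using sa that by linarith
      then have "DERIV (\<lambda>t. (sqrt a + t) powr (1 - 2*q)) t :> (1 - 2*q) * (sqrt a + t) powr (1 - 2*q - of_nat 1) * 1"
        by (intro DERIV_fun_powr) (auto intro!: derivative_eq_intros)
      from DERIV_cmult[OF DERIV_cdivide[OF this, of "1 - 2*q"], of "2 powr q"]
      show ?thesis unfolding F_def f_def
        using q by simp
    qed
    show "0 \<le> f t" for t by (simp add: f_def)
    have "((\<lambda>t. (sqrt a + t) powr (1 - 2*q)) \<longlongrightarrow> 0) at_top"
      using q by (intro tendsto_neg_powr filterlim_tendsto_add_at_top[OF tendsto_const] filterlim_ident) auto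
    then have "((\<lambda>t. 2 powr q * ((sqrt a + t) powr (1 - 2*q) / (1 - 2*q))) \<longlongrightarrow> 2 powr q * (0 / (1 - 2*q))) at_top"
      by (intro tendsto_intros) (use q in auto)
    then show "(F \<longlongrightarrow> 0) at_top" unfolding F_def by simp
  qed simp
  moreover have "0 - F 0 = 2 powr q / (2*q - 1) * a powr (1/2 - q)"
  proof -
    have "sqrt a powr (1 - 2*q) = a powr (1/2 - q)"
      using a by (simp add: powr_half_sqrt[symmetric] powr_powr field_simps)
    then have "F 0 = 2 powr q * (a powr (1/2 - q) / (1 - 2*q))" by (simp add: F_def)
    also have "\<dots> = - (2 powr q / (2*q - 1) * a powr (1/2 - q))"
      using q by (simp add: field_simps)
    finally show ?thesis by simp
  qed
  ultimately have half: "(\<integral>\<^sup>+t. ennreal (f t) * indicator {0..} t \<partial>lborel)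
      = ennreal (2 powr q / (2*q - 1) * a powr (1/2 - q))" by simp
  \<comment> \<open>Reflection \<open>t \<mapsto> -t\<close> gives the negative half-line the same
    integral. The point \<open>0\<close> may be counted twice because only an upper bound is
    sought.\<close>
  have refl: "(\<integral>\<^sup>+t. ennreal (f t) * indicator {0..} t \<partial>lborel)
      = (\<integral>\<^sup>+t. ennreal (f (-t)) * indicator {0..} (-t) \<partial>lborel)"
    by (subst nn_integral_real_affine[where t=0 and c="-1"]) auto
  have "(\<integral>\<^sup>+t. ennreal ((a + t\<^sup>2) powr (-q)) \<partial>lborel)
      \<le> (\<integral>\<^sup>+t. ennreal (f t) * indicator {0..} t + ennreal (f (-t)) * indicator {0..} (-t) \<partial>lborel)"
  proof (intro nn_integral_mono)
    fix t :: real
    show "ennreal ((a + t\<^sup>2) powr (-q)) \<le> ennreal (f t) * indicator {0..} t + ennreal (f (-t)) * indicator {0..} (-t)"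
    proof (cases "t \<ge> 0")
      case True
      then have "ennreal ((a + t\<^sup>2) powr (-q)) \<le> ennreal (f t) * indicator {0..} t"
        using powr_neg_le_shifted[of a q t] a q by (simp add: f_def ennreal_leI)
      then show ?thesis by (simp add: add_increasing2)
    next
      case False
      then have "ennreal ((a + t\<^sup>2) powr (-q)) \<le> ennreal (f (-t)) * indicator {0..} (-t)"
        using powr_neg_le_shifted[of a q "-t"] a q by (simp add: f_def ennreal_leI)
      then show ?thesis by (simp add: add_increasing)
    qed
  qed
  also have "\<dots> = (\<integral>\<^sup>+t. ennreal (f t) * indicator {0..} t \<partial>lborel)
      + (\<integral>\<^sup>+t. ennreal (f (-t)) * indicator {0..} (-t) \<partial>lborel)"
    by (rule nn_integral_add) auto
  also have "\<dots> = ennreal (2 powr q / (2*q - 1) * a powr (1/2 - q)) + ennreal (2 powr q / (2*q - 1) * a powr (1/2 - q))"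
    using half refl by simp
  also have "\<dots> = ennreal (2 * (2 powr q / (2*q - 1)) * a powr (1/2 - q))"
    using q by (subst ennreal_plus[symmetric]) auto
  finally show ?thesis .
qed

section \<open>Integration over the sphere\<close>

lemma nn_integral_sigmaN:
  fixes g :: "real ^ 'n \<Rightarrow> ennreal"
  assumes [measurable]: "g \<in> borel_measurable borel"
  shows "(\<integral>\<^sup>+v. g v \<partial>sigmaN)
    = (\<integral>\<^sup>+x. g (sphere_proj x) * indicator (ball 0 1) x \<partial>lborel) / emeasure lborel (ball (0::real^'n) 1)"
  unfolding sigmaN_def by (simp add: nn_integral_distr nn_integral_uniform_measure)

lemma integrable_sigmaN:
  fixes f :: "real ^ 'n \<Rightarrow> real"
  assumes "f \<in> borel_measurable borel" "\<And>v. v \<in> sphereN \<Longrightarrow> \<bar>f v\<bar> \<le> B"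
  shows "integrable sigmaN f"
proof (rule finite_measure.integrable_const_bound[where B = B])
  show "finite_measure (sigmaN :: (real^'n) measure)"
    using prob_space_sigmaN by (rule prob_space.finite_measure)
  show "AE v in sigmaN. norm (f v) \<le> B"
    using AE_sigmaN_sphereN by eventually_elim (use assms in auto)
  show "f \<in> borel_measurable sigmaN"
    using assms by simp
qed

lemma integral_sigmaN_mono:
  fixes f g :: "real ^ 'n \<Rightarrow> real"
  assumes "integrable sigmaN f" "integrable sigmaN g" "\<And>v. v \<in> sphereN \<Longrightarrow> f v \<le> g v"
  shows "(LINT v|sigmaN. f v) \<le> (LINT v|sigmaN. g v)"
  using assms(1,2)
proof (rule integral_mono_AE)
  show "AE v in sigmaN. f v \<le> g v"
    using AE_sigmaN_sphereN by eventually_elim (use assms in auto)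
qed

lemma measurable_vec_nth [measurable]: "(\<lambda>v::real^'n. v $ i) \<in> borel_measurable borel"
  by (intro borel_measurable_continuous_onI continuous_intros)

lemma sphereN_sum: "v \<in> sphereN \<longleftrightarrow> (\<Sum>i\<in>UNIV. (v $ i)\<^sup>2) = real CARD('n)"
  for v :: "real ^ 'n"
  by (simp add: sphereN_def norm_vec_def L2_set_def)

lemma sphereN_nth_sq_le:
  fixes v :: "real ^ 'n"
  assumes "v \<in> sphereN"
  shows "(v $ i)\<^sup>2 \<le> real CARD('n)"
proof -
  have "(v $ i)\<^sup>2 \<le> (\<Sum>i\<in>UNIV. (v $ i)\<^sup>2)"
    by (rule member_le_sum) auto
  then show ?thesis using assms by (simp add: sphereN_sum)
qed

text \<open>The N squares add up to N, so they cannot all lie below 1.\<close>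

lemma sphereN_large_coordinate:
  fixes v :: "real ^ 'n"
  assumes "v \<in> sphereN"
  obtains k where "(v $ k)\<^sup>2 \<ge> 1"
proof (rule ccontr)
  assume *: "\<not> thesis"
  have "(\<Sum>i\<in>UNIV. (v $ i)\<^sup>2) < (\<Sum>i\<in>(UNIV::'n set). 1)"
    using * that by (intro sum_strict_mono) (auto simp: not_le[symmetric])
  then show False using assms by (simp add: sphereN_sum)
qed

section \<open>The logarithm of the weight and crude bounds on the sphere\<close>

definition logsum :: "real \<Rightarrow> real ^ 'n \<Rightarrow> real" where
  "logsum a v = - (\<Sum>i\<in>UNIV. ln (a + (v $ i)\<^sup>2))"

lemma measurable_logsum [measurable]: "logsum a \<in> borel_measurable (borel :: (real^'n) measure)"
  unfolding logsum_def by measurable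

lemma measurable_G_aq [measurable]: "G_aq a q \<in> borel_measurable (borel :: (real^'n) measure)"
  unfolding G_aq_def by measurable

lemma G_aq_eq_exp:
  fixes v :: "real ^ 'n"
  assumes "a > 0"
  shows "G_aq a q v = exp (q * logsum a v)"
proof -
  have "a + (v $ i)\<^sup>2 \<noteq> 0" for i
    using assms by (simp add: add_pos_nonneg less_imp_neq[symmetric])
  then show ?thesis
    by (simp add: G_aq_def logsum_def powr_def sum_distrib_left sum_negf[symmetric] exp_sum)
qed

lemma abs_ln_coordinate_le:
  fixes v :: "real ^ 'n"
  assumes "0 < a" "a < 1" "v \<in> sphereN"
  shows "\<bar>ln (a + (v $ i)\<^sup>2)\<bar> \<le> ln (1/a) + ln (1 + real CARD('n))"
proof -
  have "ln a \<le> ln (a + (v $ i)\<^sup>2)" "ln (a + (v $ i)\<^sup>2) \<le> ln (1 + real CARD('n))"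
    using assms sphereN_nth_sq_le[OF assms(3), of i]
    by (auto intro!: ln_mono simp: add_pos_nonneg)
  moreover have "ln a < 0" "ln (1 + real CARD('n)) \<ge> 0" using assms by auto
  moreover have "ln (1/a) = - ln a" using assms by (simp add: ln_div)
  ultimately show ?thesis by linarith
qed

text \<open>A crude bound that yields integrability for fixed \<open>a\<close>. It grows only like
  \<open>ln (1/a)\<close>, so it also supplies the domination in the limit of the
  dissipation.\<close>

lemma abs_logsum_le:
  fixes v :: "real ^ 'n"
  assumes "0 < a" "a < 1" "v \<in> sphereN"
  shows "\<bar>logsum a v\<bar> \<le> real CARD('n) * (ln (1/a) + ln (1 + real CARD('n)))"
proof -
  have "\<bar>logsum a v\<bar> \<le> (\<Sum>i\<in>(UNIV::'n set). \<bar>ln (a + (v $ i)\<^sup>2)\<bar>)"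
    unfolding logsum_def by (metis abs_minus_cancel sum_abs)
  also have "\<dots> \<le> (\<Sum>i\<in>(UNIV::'n set). (ln (1/a) + ln (1 + real CARD('n))))"
    by (intro sum_mono abs_ln_coordinate_le assms)
  finally show ?thesis by simp
qed

lemma G_aq_le:
  fixes v :: "real ^ 'n"
  assumes "0 < a" "a < 1" "v \<in> sphereN" "q > 0"
  shows "G_aq a q v \<le> exp (q * (real CARD('n) * (ln (1/a) + ln (1 + real CARD('n)))))"
  using abs_logsum_le[OF assms(1-3)] assms by (simp add: G_aq_eq_exp)

lemma integrable_G_aq_mult:
  fixes f :: "real ^ 'n \<Rightarrow> real"
  assumes "0 < a" "a < 1" "q > 0" and [measurable]: "f \<in> borel_measurable borel"
    and f: "\<And>v. v \<in> sphereN \<Longrightarrow> \<bar>f v\<bar> \<le> B"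
  shows "integrable sigmaN (\<lambda>v. G_aq a q v * f v)"
proof (rule integrable_sigmaN)
  fix v :: "real^'n" assume v: "v \<in> sphereN"
  have "G_aq a q v * \<bar>f v\<bar> \<le> exp (q * (real CARD('n) * (ln (1/a) + ln (1 + real CARD('n))))) * B"
    using G_aq_le[OF assms(1,2) v assms(3)] f[OF v] by (intro mult_mono) auto
  then show "\<bar>G_aq a q v * f v\<bar> \<le> exp (q * (real CARD('n) * (ln (1/a) + ln (1 + real CARD('n))))) * B"
    using assms(1) by (simp add: abs_mult G_aq_eq_exp)
qed simp

lemma integrable_G_aq:
  assumes "0 < a" "a < 1" "q > 0"
  shows "integrable sigmaN (G_aq a q :: real ^ 'n \<Rightarrow> real)"
  using integrable_G_aq_mult[OF assms, of "\<lambda>_. 1" 1] by simp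

lemma ennreal_Z_aq:
  assumes "0 < a" "a < 1" "q > 0"
  shows "ennreal (Z_aq TYPE('n::finite) a q) = (\<integral>\<^sup>+v. ennreal (G_aq a q v) \<partial>(sigmaN :: (real^'n) measure))"
  unfolding Z_aq_def using integrable_G_aq[OF assms] assms(1)
  by (intro nn_integral_eq_integral[symmetric]) (auto simp: G_aq_eq_exp)

section \<open>The normalising constant\<close>

lemma emeasure_unit_ball:
  obtains \<beta> where "\<beta> > 0" "emeasure lborel (ball (0::real^'n) 1) = ennreal \<beta>"
proof
  show "measure lborel (ball (0::real^'n) 1) > 0"
    by (simp add: content_ball_pos)
  show "emeasure lborel (ball (0::real^'n) 1) = ennreal (measure lborel (ball (0::real^'n) 1))"
    using emeasure_lborel_ball_finite[of "0::real^'n" 1] by (simp add: emeasure_eq_ennreal_measure)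
qed

lemma sphere_proj_nth: "sphere_proj x $ i = sqrt (real CARD('n)) / norm x * x $ i"
  for x :: "real ^ 'n"
  by (simp add: sphere_proj_def)

lemma sphere_proj_in_sphereN: "x \<noteq> 0 \<Longrightarrow> sphere_proj x \<in> sphereN"
  for x :: "real ^ 'n"
  by (simp add: sphere_proj_def sphereN_def)

text \<open>Inside the unit ball the radial projection stretches by
  \<open>sqrt N / norm x \<ge> 1\<close>. Hence the weight at the projected point is at most the
  weight at \<open>x\<close>, and sphere integrals can be bounded by Lebesgue integrals of
  products.\<close>

lemma sphere_proj_nth_sq_ge:
  fixes x :: "real ^ 'n"
  assumes "x \<in> ball 0 1" "x \<noteq> 0"
  shows "(x $ i)\<^sup>2 \<le> (sphere_proj x $ i)\<^sup>2"
proof -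
  have n: "norm x < 1" "norm x > 0" using assms by auto
  then have "(norm x)\<^sup>2 \<le> 1" by (simp add: power_le_one)
  also have "1 \<le> real CARD('n)" by simp
  finally have "1 \<le> real CARD('n) / (norm x)\<^sup>2"
    using n by (simp add: pos_le_divide_eq)
  then have "1 * (x $ i)\<^sup>2 \<le> real CARD('n) / (norm x)\<^sup>2 * (x $ i)\<^sup>2"
    by (rule mult_right_mono) simp
  then show ?thesis by (simp add: sphere_proj_nth power_mult_distrib power_divide)
qed

lemma powr_eq_exp_ln_inverse:
  fixes a :: real
  assumes "0 < a"
  shows "(a powr (1/2 - q)) ^ n = exp (real n * (q - 1/2) * ln (1/a))"
  using assms by (simp add: powr_def ln_div exp_of_nat_mult[symmetric] algebra_simps)

text \<open>If coordinate \<open>k\<close> of the projected point has square at least 1, its factor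
  is at most 1, while every other factor is at most its value at the unprojected coordinate. Summing
  over the possible \<open>k\<close> gives products that integrate coordinatewise, each with N - 1
  integrals of order \<open>a powr (1/2 - q)\<close>.\<close>

lemma Z_aq_upper:
  assumes q: "q > 1/2"
  obtains C where "C > 0" "\<And>a. 0 < a \<Longrightarrow> a < 1 \<Longrightarrow>
    Z_aq TYPE('n::finite) a q \<le> C * exp ((real CARD('n) - 1) * (q - 1/2) * ln (1/a))"
proof -
  obtain \<beta> where \<beta>: "\<beta> > 0" "emeasure lborel (ball (0::real^'n) 1) = ennreal \<beta>"
    by (rule emeasure_unit_ball)
  define n where "n = CARD('n) - 1"
  have n: "real n = real CARD('n) - 1" by (simp add: n_def of_nat_diff)
  define D where "D = 2 * (2 powr q / (2*q - 1))"
  have D: "D > 0" using q by (simp add: D_def)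
  define C where "C = real CARD('n) * 2 * D ^ n / \<beta>"
  show thesis
  proof
    show "C > 0" using D \<beta> by (simp add: C_def)
    fix a :: real assume a: "0 < a" "a < 1"
    \<comment> \<open>The indicator keeps the integral over coordinate \<open>k\<close> finite; it
      loses nothing because \<open>x $ k\<close> lies in \<open>{-1..1}\<close> on the unit
      ball.\<close>
    define g :: "'n \<Rightarrow> 'n \<Rightarrow> real \<Rightarrow> real"
      where "g k i t = (if i = k then indicator {-1..1} t else (a + t\<^sup>2) powr (-q))" for k i t
    have [measurable]: "g k i \<in> borel_measurable borel" for k i
      unfolding g_def by (cases "i = k") simp_all
    have g0: "0 \<le> g k i t" for k i t by (simp add: g_def)
    have bound: "G_aq a q (sphere_proj x) \<le> (\<Sum>k\<in>UNIV. \<Prod>i\<in>UNIV. g k i (x $ i))"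
      if x: "x \<in> ball 0 1" "x \<noteq> 0" for x :: "real^'n"
    proof -
      obtain k where k: "(sphere_proj x $ k)\<^sup>2 \<ge> 1"
        using sphereN_large_coordinate[OF sphere_proj_in_sphereN[OF x(2)]] .
      have "G_aq a q (sphere_proj x) \<le> (\<Prod>i\<in>UNIV. g k i (x $ i))"
        unfolding G_aq_def
      proof (intro prod_mono conjI)
        fix i
        show "(a + (sphere_proj x $ i)\<^sup>2) powr - q \<le> g k i (x $ i)"
        proof (cases "i = k")
          case True
          have "(a + (sphere_proj x $ k)\<^sup>2) powr - q \<le> 1 powr - q"
            using k a q by (intro powr_mono2') auto
          moreover have "\<bar>x $ k\<bar> \<le> 1"
            using component_le_norm_cart[of x k] x by simp
          ultimately show ?thesis using True by (auto simp: g_def indicator_def)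
        next
          case False
          then show ?thesis
            using sphere_proj_nth_sq_ge[OF x, of i] a q
            by (auto simp: g_def add_pos_nonneg intro!: powr_mono2')
        qed
      qed simp
      also have "\<dots> \<le> (\<Sum>k\<in>UNIV. \<Prod>i\<in>UNIV. g k i (x $ i))"
        by (rule member_le_sum[where f = "\<lambda>k. \<Prod>i\<in>UNIV. g k i (x $ i)"])
          (auto intro!: prod_nonneg g0)
      finally show ?thesis .
    qed
    define I where "I = (\<integral>\<^sup>+t. ennreal ((a + t\<^sup>2) powr (-q)) \<partial>lborel)"
    have I_le: "I \<le> ennreal (D * a powr (1/2 - q))"
      unfolding I_def D_def by (rule nn_integral_powr_neg_le) (use a q in auto)
    then obtain r where r: "I = ennreal r" "0 \<le> r" "r \<le> D * a powr (1/2 - q)"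
      using D by (cases I) (auto simp: top_unique)
    have int_g: "(\<Prod>i\<in>UNIV. (\<integral>\<^sup>+t. ennreal (g k i t) \<partial>lborel)) = ennreal (2 * r ^ n)" for k
    proof -
      have "(\<Prod>i\<in>UNIV. (\<integral>\<^sup>+t. ennreal (g k i t) \<partial>lborel))
          = (\<integral>\<^sup>+t. ennreal (g k k t) \<partial>lborel) * (\<Prod>i\<in>UNIV - {k}. (\<integral>\<^sup>+t. ennreal (g k i t) \<partial>lborel))"
        by (rule prod.remove) auto
      also have "(\<Prod>i\<in>UNIV - {k}. (\<integral>\<^sup>+t. ennreal (g k i t) \<partial>lborel)) = (\<Prod>i\<in>UNIV - {k}. I)"
        by (rule prod.cong) (auto simp: g_def I_def)
      also have "\<dots> = ennreal (r ^ n)"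
        using r by (simp add: n_def ennreal_power)
      also have "(\<integral>\<^sup>+t. ennreal (g k k t) \<partial>lborel) = ennreal 2"
        by (simp add: g_def ennreal_indicator)
      finally show ?thesis using r by (simp add: ennreal_mult')
    qed
    have "ennreal (Z_aq TYPE('n) a q) =
        (\<integral>\<^sup>+x. ennreal (G_aq a q (sphere_proj x)) * indicator (ball (0::real^'n) 1) x \<partial>lborel) / ennreal \<beta>"
      using a q by (simp add: ennreal_Z_aq nn_integral_sigmaN \<beta>)
    also have "\<dots> \<le> (\<integral>\<^sup>+x. (\<Sum>k\<in>UNIV. \<Prod>i\<in>UNIV. ennreal (g k i ((x::real^'n) $ i))) \<partial>lborel) / ennreal \<beta>"
    proof (intro divide_right_mono_ennreal nn_integral_mono_AE)
      have "AE x in lborel. x \<noteq> (0 :: real ^ 'n)"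
        by (rule AE_lborel_singleton)
      then show "AE x in lborel. ennreal (G_aq a q (sphere_proj x)) * indicator (ball (0::real^'n) 1) x
          \<le> (\<Sum>k\<in>UNIV. \<Prod>i\<in>UNIV. ennreal (g k i (x $ i)))"
      proof eventually_elim
        fix x :: "real^'n" assume "x \<noteq> 0"
        then show "ennreal (G_aq a q (sphere_proj x)) * indicator (ball 0 1) x
          \<le> (\<Sum>k\<in>UNIV. \<Prod>i\<in>UNIV. ennreal (g k i (x $ i)))"
          using bound[of x]
          by (auto simp: indicator_def prod_ennreal g0 sum_ennreal prod_nonneg intro!: ennreal_leI)
      qed
    qed
    also have "(\<integral>\<^sup>+x. (\<Sum>k\<in>UNIV. \<Prod>i\<in>UNIV. ennreal (g k i ((x::real^'n) $ i))) \<partial>lborel)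
        = (\<Sum>k\<in>(UNIV::'n set). \<Prod>i\<in>UNIV. (\<integral>\<^sup>+t. ennreal (g k i t) \<partial>lborel))"
      by (subst nn_integral_sum) (auto simp: nn_integral_lborel_prod_cart[where f = "\<lambda>i t. ennreal (g _ i t)"])
    also have "\<dots> = ennreal (real CARD('n) * (2 * r ^ n))"
      using r by (simp add: int_g ennreal_mult ennreal_of_nat_eq_real_of_nat)
    also have "\<dots> / ennreal \<beta> = ennreal (real CARD('n) * (2 * r ^ n) / \<beta>)"
      using r \<beta> by (simp add: divide_ennreal)
    finally have "Z_aq TYPE('n) a q \<le> real CARD('n) * (2 * r ^ n) / \<beta>"
      using r \<beta> by (subst (asm) ennreal_le_iff) auto
    also have "\<dots> \<le> real CARD('n) * (2 * (D * a powr (1/2 - q)) ^ n) / \<beta>"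
      using r \<beta> by (intro divide_right_mono mult_left_mono power_mono) auto
    also have "\<dots> = C * exp ((real CARD('n) - 1) * (q - 1/2) * ln (1/a))"
      using powr_eq_exp_ln_inverse[OF a(1), of q n]
      by (simp add: C_def power_mult_distrib n)
    finally show "Z_aq TYPE('n) a q \<le> C * exp ((real CARD('n) - 1) * (q - 1/2) * ln (1/a))" .
  qed
qed

text \<open>The integral is restricted to a box in which one coordinate has order 1 and the others
  have order \<open>sqrt a\<close>. There each small coordinate contributes a factor of at least
  \<open>(2*a) powr (-q)\<close> over a width \<open>2 * c * sqrt a\<close>, which matches the upper
  bound up to constants.\<close>

lemma Z_aq_lower:
  assumes q: "q > 1/2"
  obtains C where "C > 0" "\<And>a. 0 < a \<Longrightarrow> a < 1 \<Longrightarrow>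
    Z_aq TYPE('n::finite) a q \<ge> C * exp ((real CARD('n) - 1) * (q - 1/2) * ln (1/a))"
proof -
  obtain \<beta> where \<beta>: "\<beta> > 0" "emeasure lborel (ball (0::real^'n) 1) = ennreal \<beta>"
    by (rule emeasure_unit_ball)
  define n where "n = CARD('n) - 1"
  have n: "real n = real CARD('n) - 1" by (simp add: n_def of_nat_diff)
  \<comment> \<open>This value serves twice: \<open>1/2 + (N - 1) * c < 1\<close> keeps the box
    inside the unit ball, and with \<open>norm x \<ge> 1/4\<close> the squares of the projected
    small coordinates are at most \<open>16 * N * c\<^sup>2 * a = a / N \<le> a\<close>.\<close>
  define c where "c = 1 / (4 * real CARD('n))"
  have c: "c > 0" by (simp add: c_def)
  define C where "C = (1 + real CARD('n)) powr (-q) * (1/4) * (2 powr (-q) * 2 * c) ^ n / \<beta>"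
  show thesis
  proof
    show "C > 0" using c \<beta> by (simp add: C_def)
    fix a :: real assume a: "0 < a" "a < 1"
    \<comment> \<open>Any single coordinate can play the large one, since a lower bound needs only
      one box.\<close>
    fix k :: 'n
    define h :: "'n \<Rightarrow> real \<Rightarrow> real"
      where "h i t = (if i = k then (1 + real CARD('n)) powr (-q) * indicator {1/4..1/2} t
        else (2*a) powr (-q) * indicator {-(c * sqrt a)..c * sqrt a} t)" for i t
    have [measurable]: "h i \<in> borel_measurable borel" for i
      unfolding h_def by (cases "i = k") simp_all
    have h0: "0 \<le> h i t" for i t by (simp add: h_def)
    have bound: "(\<Prod>i\<in>UNIV. h i (x $ i)) \<le> G_aq a q (sphere_proj x) * indicator (ball 0 1) x"
      for x :: "real^'n"
    proof (cases "x $ k \<in> {1/4..1/2} \<and> (\<forall>i. i \<noteq> k \<longrightarrow> x $ i \<in> {-(c * sqrt a)..c * sqrt a})")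
      \<comment> \<open>Outside the box some factor of the product vanishes.\<close>
      case False
      then obtain i where "h i (x $ i) = 0"
        by (metis h_def indicator_simps(2) mult_zero_right)
      then have 0: "(\<Prod>i\<in>UNIV. h i (x $ i)) = 0"
        by (auto simp: prod_zero_iff)
      show ?thesis unfolding 0
        by (simp add: G_aq_def prod_nonneg)
    next
      case True
      have small: "\<bar>x $ i\<bar> \<le> c * sqrt a" if "i \<noteq> k" for i
        using True that by (simp add: abs_le_iff) (metis minus_le_iff)
      have "norm x \<le> (\<Sum>i\<in>UNIV. \<bar>x $ i\<bar>)" by (rule norm_le_l1_cart)
      also have "\<dots> = \<bar>x $ k\<bar> + (\<Sum>i\<in>UNIV - {k}. \<bar>x $ i\<bar>)"
        by (rule sum.remove) auto
      also have "\<dots> \<le> 1/2 + (\<Sum>i\<in>UNIV - {k}. c)"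
      proof (intro add_mono sum_mono)
        fix i assume "i \<in> UNIV - {k}"
        then have "\<bar>x $ i\<bar> \<le> c * sqrt a" using small by simp
        also have "\<dots> \<le> c * 1" using a c by (intro mult_left_mono) auto
        finally show "\<bar>x $ i\<bar> \<le> c" by simp
      qed (use True in auto)
      also have "\<dots> = 1/2 + real n * c" by (simp add: n_def)
      also have "\<dots> < 1" by (simp add: n c_def field_simps)
      finally have x1: "x \<in> ball 0 1" by simp
      have x4: "norm x \<ge> 1/4"
        using component_le_norm_cart[of x k] True by auto
      then have x0: "x \<noteq> 0" by auto
      have "(\<Prod>i\<in>UNIV. h i (x $ i)) \<le> G_aq a q (sphere_proj x)"
        unfolding G_aq_def
      proof (intro prod_mono conjI h0)
        fix i
        show "h i (x $ i) \<le> (a + (sphere_proj x $ i)\<^sup>2) powr - q"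
        proof (cases "i = k")
          case [simp]: True
          have "(1 + real CARD('n)) powr (-q) \<le> (a + (sphere_proj x $ k)\<^sup>2) powr - q"
            using a q sphereN_nth_sq_le[OF sphere_proj_in_sphereN[OF x0], of k]
            by (intro powr_mono2') (auto simp: add_pos_nonneg)
          then show ?thesis
            by (auto simp: h_def indicator_def)
        next
          case False
          have "(sphere_proj x $ i)\<^sup>2 = real CARD('n) / (norm x)\<^sup>2 * \<bar>x $ i\<bar>\<^sup>2"
            by (simp add: sphere_proj_nth power_mult_distrib power_divide)
          also have "\<dots> \<le> real CARD('n) / (1/4)\<^sup>2 * (c * sqrt a)\<^sup>2"
            using small[OF False] x4 x0 by (intro mult_mono divide_left_mono power_mono) auto
          also have "\<dots> = a / real CARD('n)"
            using a by (simp add: c_def power_mult_distrib power_divide) (simp add: power2_eq_square)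
          also have "\<dots> \<le> a / 1" using a by (intro divide_left_mono) auto
          finally have "(2*a) powr (-q) \<le> (a + (sphere_proj x $ i)\<^sup>2) powr - q"
            using a q by (intro powr_mono2') (auto simp: add_pos_nonneg)
          then show ?thesis using False
            by (auto simp: h_def indicator_def)
        qed
      qed
      then show ?thesis using x1 by simp
    qed
    have int_h: "(\<Prod>i\<in>UNIV. (\<integral>\<^sup>+t. ennreal (h i t) \<partial>lborel))
        = ennreal ((1 + real CARD('n)) powr (-q) * (1/4) * ((2*a) powr (-q) * (2 * (c * sqrt a))) ^ n)"
    proof -
      have ind: "(\<integral>\<^sup>+t. ennreal (w * indicator {u..u'} t) \<partial>lborel) = ennreal (w * (u' - u))"
        if "w \<ge> 0" "u \<le> u'" for w u u' :: real
        using that by (simp add: ennreal_mult ennreal_indicator nn_integral_cmult)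
      have "(\<Prod>i\<in>UNIV. (\<integral>\<^sup>+t. ennreal (h i t) \<partial>lborel))
          = (\<integral>\<^sup>+t. ennreal (h k t) \<partial>lborel) * (\<Prod>i\<in>UNIV - {k}. (\<integral>\<^sup>+t. ennreal (h i t) \<partial>lborel))"
        by (rule prod.remove) auto
      also have "(\<Prod>i\<in>UNIV - {k}. (\<integral>\<^sup>+t. ennreal (h i t) \<partial>lborel))
          = (\<Prod>i\<in>UNIV - {k}. ennreal ((2*a) powr (-q) * (2 * (c * sqrt a))))"
        using c a by (intro prod.cong) (auto simp: h_def ind)
      also have "\<dots> = ennreal (((2*a) powr (-q) * (2 * (c * sqrt a))) ^ n)"
        using c a by (simp add: n_def ennreal_power)
      also have "(\<integral>\<^sup>+t. ennreal (h k t) \<partial>lborel) = ennreal ((1 + real CARD('n)) powr (-q) * (1/4))"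
        by (simp add: h_def ind)
      finally show ?thesis by (simp add: ennreal_mult'[symmetric])
    qed
    have "ennreal ((1 + real CARD('n)) powr (-q) * (1/4) * ((2*a) powr (-q) * (2 * (c * sqrt a))) ^ n / \<beta>)
        = (\<integral>\<^sup>+x. (\<Prod>i\<in>UNIV. ennreal (h i ((x::real^'n) $ i))) \<partial>lborel) / ennreal \<beta>"
      using a c \<beta> by (subst nn_integral_lborel_prod_cart[where f = "\<lambda>i t. ennreal (h i t)"])
        (simp_all add: int_h divide_ennreal)
    also have "\<dots> \<le> (\<integral>\<^sup>+x. ennreal (G_aq a q (sphere_proj x)) * indicator (ball (0::real^'n) 1) x \<partial>lborel) / ennreal \<beta>"
    proof (intro divide_right_mono_ennreal nn_integral_mono)
      fix x :: "real^'n"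
      have "(\<Prod>i\<in>UNIV. ennreal (h i (x $ i))) \<le> ennreal (G_aq a q (sphere_proj x) * indicator (ball 0 1) x)"
        using bound[of x] by (simp add: prod_ennreal h0 ennreal_leI)
      then show "(\<Prod>i\<in>UNIV. ennreal (h i (x $ i))) \<le> ennreal (G_aq a q (sphere_proj x)) * indicator (ball 0 1) x"
        by (cases "x \<in> ball 0 1") (simp_all del: prod_zero_iff)
    qed
    also have "\<dots> = ennreal (Z_aq TYPE('n) a q)"
      using a q by (simp add: ennreal_Z_aq nn_integral_sigmaN \<beta>)
    finally have "(1 + real CARD('n)) powr (-q) * (1/4) * ((2*a) powr (-q) * (2 * (c * sqrt a))) ^ n / \<beta>
        \<le> Z_aq TYPE('n) a q"
      by (subst (asm) ennreal_le_iff) (use a in \<open>auto simp: Z_aq_def G_aq_eq_exp\<close>)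
    also have "(2*a) powr (-q) * (2 * (c * sqrt a)) = (2 powr (-q) * 2 * c) * a powr (1/2 - q)"
    proof -
      have "a powr (1/2 - q) = sqrt a * a powr (-q)"
        using a by (simp add: powr_half_sqrt[symmetric] powr_add[symmetric])
      then show ?thesis using a by (simp add: powr_mult)
    qed
    finally show "Z_aq TYPE('n) a q \<ge> C * exp ((real CARD('n) - 1) * (q - 1/2) * ln (1/a))"
      using powr_eq_exp_ln_inverse[OF a(1), of q n]
      by (simp add: C_def power_mult_distrib n)
  qed
qed

lemma Z_aq_pos:
  assumes "q > 1/2" "0 < a" "a < 1"
  shows "Z_aq TYPE('n::finite) a q > 0"
proof -
  obtain C where "C > 0" "\<And>a. 0 < a \<Longrightarrow> a < 1 \<Longrightarrow>
    Z_aq TYPE('n) a q \<ge> C * exp ((real CARD('n) - 1) * (q - 1/2) * ln (1/a))"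
    using Z_aq_lower[OF assms(1)] by blast
  with assms show ?thesis
    by (meson exp_gt_zero less_le_trans mult_pos_pos)
qed

lemma Z_aq_asymp:
  assumes q: "q > 1/2"
  obtains K where "\<And>a. 0 < a \<Longrightarrow> a < 1 \<Longrightarrow>
    \<bar>ln (Z_aq TYPE('n::finite) a q) - (real CARD('n) - 1) * (q - 1/2) * ln (1/a)\<bar> \<le> K"
proof -
  obtain C where C: "C > 0" "\<And>a. 0 < a \<Longrightarrow> a < 1 \<Longrightarrow>
    Z_aq TYPE('n) a q \<ge> C * exp ((real CARD('n) - 1) * (q - 1/2) * ln (1/a))"
    using Z_aq_lower[OF q] by blast
  obtain D where D: "D > 0" "\<And>a. 0 < a \<Longrightarrow> a < 1 \<Longrightarrow>
    Z_aq TYPE('n) a q \<le> D * exp ((real CARD('n) - 1) * (q - 1/2) * ln (1/a))"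
    using Z_aq_upper[OF q] by blast
  show thesis
  proof
    fix a :: real assume a: "0 < a" "a < 1"
    let ?e = "(real CARD('n) - 1) * (q - 1/2) * ln (1/a)"
    have Z: "Z_aq TYPE('n) a q > 0" by (rule Z_aq_pos[OF q a])
    have "ln (C * exp ?e) \<le> ln (Z_aq TYPE('n) a q)" "ln (Z_aq TYPE('n) a q) \<le> ln (D * exp ?e)"
      using C D a Z by (auto intro!: ln_mono simp del: ln_mult)
    moreover have "ln (C * exp ?e) = ln C + ?e" "ln (D * exp ?e) = ln D + ?e"
      using C(1) D(1) by (simp_all add: ln_mult)
    ultimately show "\<bar>ln (Z_aq TYPE('n) a q) - ?e\<bar> \<le> \<bar>ln C\<bar> + \<bar>ln D\<bar>" by linarith
  qed
qed

section \<open>The defect and the entropy\<close>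

text \<open>This is \<open>ln (a + t\<^sup>2)\<close> minus its minimum \<open>ln a\<close>: bounded
  for \<open>t\<close> of order \<open>sqrt a\<close> and equal to \<open>ln (1/a)\<close> up to a
  constant for \<open>t\<close> of order 1. It therefore counts, in units of
  \<open>ln (1/a)\<close>, how many coordinates are large.\<close>

definition log_excess :: "real \<Rightarrow> real \<Rightarrow> real" where
  "log_excess a t = ln (1 + t\<^sup>2 / a)"

lemma log_excess_nonneg: "0 < a \<Longrightarrow> 0 \<le> log_excess a t"
  by (simp add: log_excess_def)

lemma log_excess_eq: "0 < a \<Longrightarrow> log_excess a t = ln (a + t\<^sup>2) + ln (1/a)"
proof -
  assume a: "0 < a"
  then have "1 + t\<^sup>2 / a = (a + t\<^sup>2) * (1/a)" by (simp add: field_simps)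
  then show ?thesis unfolding log_excess_def
    using a by (simp only: ln_mult_pos[OF add_pos_nonneg[OF a zero_le_power2]] zero_less_divide_1_iff)
qed

lemma log_excess_ge:
  assumes "0 < a" "m > 0" "m \<le> t\<^sup>2"
  shows "log_excess a t \<ge> ln m + ln (1/a)"
proof -
  have "ln m \<le> ln (a + t\<^sup>2)" using assms by (intro ln_mono) auto
  then show ?thesis using assms by (simp add: log_excess_eq)
qed

lemma log_excess_le:
  assumes "0 < a" "a < 1" "t\<^sup>2 \<le> m"
  shows "log_excess a t \<le> ln (1 + m) + ln (1/a)"
proof -
  have "ln (a + t\<^sup>2) \<le> ln (1 + m)" using assms by (intro ln_mono) (auto simp: add_pos_nonneg)
  then show ?thesis using assms by (simp add: log_excess_eq)
qed

definition defect :: "real \<Rightarrow> real ^ 'n \<Rightarrow> real" where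
  "defect a v = (real CARD('n) - 1) * ln (1/a) - logsum a v"

lemma measurable_defect [measurable]: "defect a \<in> borel_measurable (borel :: (real^'n) measure)"
  unfolding defect_def by measurable

text \<open>The two sides differ exactly by \<open>ln (a + (v $ k)\<^sup>2)\<close>, which is
  nonnegative. Thus the defect controls every coordinate other than a large one.\<close>

lemma sum_log_excess_le_defect:
  fixes v :: "real ^ 'n"
  assumes a: "0 < a" and k: "(v $ k)\<^sup>2 \<ge> 1"
  shows "(\<Sum>i\<in>UNIV - {k}. log_excess a (v $ i)) \<le> defect a v"
proof -
  have "(\<Sum>i\<in>UNIV - {k}. log_excess a (v $ i))
      = (\<Sum>i\<in>UNIV - {k}. ln (a + (v $ i)\<^sup>2)) + (real CARD('n) - 1) * ln (1/a)"
    using a by (simp add: log_excess_eq sum.distrib of_nat_diff)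
  moreover have "(\<Sum>i\<in>UNIV. ln (a + (v $ i)\<^sup>2)) = ln (a + (v $ k)\<^sup>2) + (\<Sum>i\<in>UNIV - {k}. ln (a + (v $ i)\<^sup>2))"
    by (rule sum.remove) auto
  moreover have "ln (a + (v $ k)\<^sup>2) \<ge> 0" using a k by simp
  ultimately show ?thesis unfolding defect_def logsum_def by linarith
qed

lemma defect_nonneg:
  fixes v :: "real ^ 'n"
  assumes a: "0 < a" and v: "v \<in> sphereN"
  shows "0 \<le> defect a v"
proof -
  obtain k where k: "(v $ k)\<^sup>2 \<ge> 1" using sphereN_large_coordinate[OF v] .
  have "0 \<le> (\<Sum>i\<in>UNIV - {k}. log_excess a (v $ i))"
    using a by (intro sum_nonneg log_excess_nonneg)
  then show ?thesis using sum_log_excess_le_defect[OF a k] by linarith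
qed

lemma integrable_G_aq_logsum:
  assumes "0 < a" "a < 1" "q > 0"
  shows "integrable sigmaN (\<lambda>v::real^'n. G_aq a q v * logsum a v)"
  by (rule integrable_G_aq_mult[OF assms]) (use assms abs_logsum_le in auto)

lemma integrable_G_aq_defect:
  assumes "0 < a" "a < 1" "q > 0"
  shows "integrable sigmaN (\<lambda>v::real^'n. G_aq a q v * defect a v)"
  using integrable_G_aq[OF assms, where 'n='n] integrable_G_aq_logsum[OF assms, where 'n='n]
  by (simp add: defect_def right_diff_distrib)

text \<open>Multiplying the weight by \<open>exp (c * defect a v)\<close> lowers its exponent to
  \<open>q - c\<close> at the price of the factor \<open>exp ((N - 1) * c * ln (1/a))\<close>. The
  two normalising constants differ in order by precisely this factor, so all dependence on
  \<open>a\<close> cancels.\<close>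

lemma integral_G_aq_defect:
  assumes q: "q > 1/2"
  obtains K where "K \<ge> 0" "\<And>a. 0 < a \<Longrightarrow> a < 1 \<Longrightarrow>
    (LINT v|(sigmaN :: (real^'n) measure). G_aq a q v * defect a v) \<in> {0..K * Z_aq TYPE('n) a q}"
proof -
  \<comment> \<open>Half of the available room, so that \<open>q - c\<close> still exceeds
    \<open>1/2\<close> and the upper bound for the normalising constant applies to it.\<close>
  define c where "c = (q - 1/2) / 2"
  have c: "c > 0" "q - c > 1/2" using q by (auto simp: c_def field_simps)
  obtain C where C: "C > 0" "\<And>a. 0 < a \<Longrightarrow> a < 1 \<Longrightarrow>
    Z_aq TYPE('n) a q \<ge> C * exp ((real CARD('n) - 1) * (q - 1/2) * ln (1/a))"
    using Z_aq_lower[OF q] by blast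
  obtain D where D: "D > 0" "\<And>a. 0 < a \<Longrightarrow> a < 1 \<Longrightarrow>
    Z_aq TYPE('n) a (q - c) \<le> D * exp ((real CARD('n) - 1) * (q - c - 1/2) * ln (1/a))"
    using Z_aq_upper[OF c(2)] by blast
  show thesis
  proof
    show "D / (c * C) \<ge> 0" using C D c by simp
    fix a :: real assume a: "0 < a" "a < 1"
    let ?E = "\<lambda>s. exp ((real CARD('n) - 1) * s * ln (1/a))"
    have G0: "0 < G_aq a q v" for v :: "real^'n" using a by (simp add: G_aq_eq_exp)
    have pt: "G_aq a q v * defect a v \<le> ?E c / c * G_aq a (q - c) v" for v :: "real^'n"
    proof -
      have "c * defect a v \<le> exp (c * defect a v)"
        using exp_ge_add_one_self[of "c * defect a v"] by linarith
      then have "defect a v \<le> exp (c * defect a v) / c"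
        using c by (simp add: pos_le_divide_eq mult.commute)
      then have "G_aq a q v * defect a v \<le> G_aq a q v * (exp (c * defect a v) / c)"
        using G0[of v] by (intro mult_left_mono) auto
      also have "\<dots> = ?E c / c * G_aq a (q - c) v"
        using a by (simp add: G_aq_eq_exp defect_def exp_add[symmetric] exp_diff[symmetric] algebra_simps)
      finally show ?thesis .
    qed
    have "(LINT v|(sigmaN :: (real^'n) measure). G_aq a q v * defect a v)
        \<le> (LINT v|(sigmaN :: (real^'n) measure). ?E c / c * G_aq a (q - c) v)"
      using a c q pt integrable_G_aq[of a "q - c", where 'n='n]
      by (intro integral_mono integrable_G_aq_defect) auto
    also have "\<dots> = ?E c / c * Z_aq TYPE('n) a (q - c)"
      by (simp add: Z_aq_def)
    also have "\<dots> \<le> ?E c / c * (D * ?E (q - c - 1/2))"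
      using D(2)[OF a] c by (intro mult_left_mono) auto
    also have "\<dots> = D / c * ?E (q - 1/2)"
      by (simp add: exp_add[symmetric] algebra_simps)
    also have "\<dots> \<le> D / c * (Z_aq TYPE('n) a q / C)"
      using C(2)[OF a] C(1) D(1) c by (intro mult_left_mono) (auto simp: pos_le_divide_eq mult.commute)
    also have "\<dots> = D / (c * C) * Z_aq TYPE('n) a q" by simp
    finally have "(LINT v|(sigmaN :: (real^'n) measure). G_aq a q v * defect a v)
      \<le> D / (c * C) * Z_aq TYPE('n) a q" .
    moreover have "0 \<le> (LINT v|(sigmaN :: (real^'n) measure). G_aq a q v * defect a v)"
    proof (rule integral_nonneg_AE)
      show "AE v in (sigmaN :: (real^'n) measure). 0 \<le> G_aq a q v * defect a v"
        using AE_sigmaN_sphereN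
        by eventually_elim (intro mult_nonneg_nonneg defect_nonneg a less_imp_le[OF G0])
    qed
    ultimately show "(LINT v|(sigmaN :: (real^'n) measure). G_aq a q v * defect a v)
      \<in> {0..D / (c * C) * Z_aq TYPE('n) a q}" by simp
  qed
qed

lemma ln_F_aq:
  fixes v :: "real ^ 'n"
  assumes "q > 1/2" "0 < a" "a < 1"
  shows "ln (F_aq a q v) = q * logsum a v - ln (Z_aq TYPE('n) a q)"
  using assms Z_aq_pos[OF assms, where 'n='n] by (simp add: F_aq_def G_aq_eq_exp ln_div)

text \<open>The logarithm of the density is
  \<open>q * (N - 1) * ln (1/a) - ln Z - q * defect\<close>. The defect has bounded mean, and
  \<open>ln Z\<close> is \<open>(N - 1) * (q - 1/2) * ln (1/a)\<close> up to a bounded error; the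
  difference of the leading terms is \<open>(N - 1) / 2 * ln (1/a)\<close>.\<close>

lemma entropyN_F_aq_asymp:
  assumes q: "q > 1/2"
  obtains K where "\<And>a. 0 < a \<Longrightarrow> a < 1 \<Longrightarrow>
    \<bar>entropyN (F_aq a q :: real ^ 'n \<Rightarrow> real) - (real CARD('n) - 1) / 2 * ln (1/a)\<bar> \<le> K"
proof -
  obtain K where K: "\<And>a. 0 < a \<Longrightarrow> a < 1 \<Longrightarrow>
    \<bar>ln (Z_aq TYPE('n) a q) - (real CARD('n) - 1) * (q - 1/2) * ln (1/a)\<bar> \<le> K"
    using Z_aq_asymp[OF q, where 'n='n] by blast
  obtain K' where K': "\<And>a. 0 < a \<Longrightarrow> a < 1 \<Longrightarrow>
    (LINT v|(sigmaN :: (real^'n) measure). G_aq a q v * defect a v) \<in> {0..K' * Z_aq TYPE('n) a q}"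
    using integral_G_aq_defect[OF q, where 'n='n] by blast
  show thesis
  proof
    fix a :: real assume a: "0 < a" "a < 1"
    let ?Z = "Z_aq TYPE('n) a q" and ?N = "real CARD('n)"
    let ?D = "LINT v|(sigmaN :: (real^'n) measure). G_aq a q v * defect a v"
    have Z: "?Z > 0" by (rule Z_aq_pos[OF q a])
    have q0: "q > 0" using q by simp
    note int = integrable_G_aq[OF a q0, where 'n='n] integrable_G_aq_defect[OF a q0, where 'n='n]
    \<comment> \<open>The value of the logarithm of the density where the defect is zero.\<close>
    define w where "w = q * (?N - 1) * ln (1/a) - ln ?Z"
    have "F_aq a q v * ln (F_aq a q v) = (w / ?Z) * G_aq a q v - q / ?Z * (G_aq a q v * defect a v)"
      for v :: "real^'n"
      unfolding ln_F_aq[OF q a] using Z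
      by (simp add: F_aq_def defect_def w_def field_simps)
    then have "entropyN (F_aq a q :: real ^ 'n \<Rightarrow> real) = w / ?Z * ?Z - q / ?Z * ?D"
      unfolding entropyN_def using int by (simp add: Z_aq_def)
    also have "\<dots> = w - q * (?D / ?Z)" using Z by simp
    finally have eq: "entropyN (F_aq a q :: real ^ 'n \<Rightarrow> real) - (?N - 1) / 2 * ln (1/a)
        = - (ln ?Z - (?N - 1) * (q - 1/2) * ln (1/a)) - q * (?D / ?Z)"
      by (simp add: w_def algebra_simps)
    have "0 \<le> ?D / ?Z" "?D / ?Z \<le> K'" using K'[OF a] Z by (auto simp: pos_divide_le_eq)
    then have "0 \<le> q * (?D / ?Z)" "q * (?D / ?Z) \<le> q * K'" using q0 by (simp_all only: mult_nonneg_nonneg mult_left_mono less_imp_le)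
    then show "\<bar>entropyN (F_aq a q :: real ^ 'n \<Rightarrow> real) - (?N - 1) / 2 * ln (1/a)\<bar> \<le> K + q * K'"
      unfolding eq using K[OF a] by linarith
  qed
qed

section \<open>From bounded errors to limits\<close>

lemma filterlim_ln_inverse_at_right_0: "filterlim (\<lambda>a::real. ln (1/a)) at_top (at_right 0)"
  by real_asymp

lemma tendsto_div_ln_inverseI:
  fixes f :: "real \<Rightarrow> real"
  assumes "\<And>a. 0 < a \<Longrightarrow> a < 1 \<Longrightarrow> \<bar>f a - L * ln (1/a)\<bar> \<le> K"
  shows "((\<lambda>a. f a / ln (1/a)) \<longlongrightarrow> L) (at_right 0)"
proof (rule LIM_zero_cancel)
  have ev: "\<forall>\<^sub>F a in at_right 0. 0 < a \<and> a < (1::real)"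
    by (auto simp: eventually_at_right_field intro: exI[of _ 1])
  have "((\<lambda>a. K / ln (1/a)) \<longlongrightarrow> 0) (at_right 0)"
    by (rule tendsto_divide_0[OF tendsto_const filterlim_at_top_imp_at_infinity[OF filterlim_ln_inverse_at_right_0]])
  moreover have "\<forall>\<^sub>F a in at_right 0. norm (f a / ln (1/a) - L) \<le> K / ln (1/a)"
    using ev
  proof eventually_elim
    case (elim a)
    then have l: "ln (1/a) > 0" by simp
    then have "f a / ln (1/a) - L = (f a - L * ln (1/a)) / ln (1/a)" by (simp add: field_simps)
    then show ?case using assms[of a] elim l by (simp add: abs_divide divide_right_mono del: ln_div)
  qed
  ultimately show "((\<lambda>a. f a / ln (1/a) - L) \<longlongrightarrow> 0) (at_right 0)"
    by (rule Lim_null_comparison[rotated])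
qed

section \<open>Rotations of a coordinate plane\<close>

lemma sum_UNIV_pair:
  fixes f :: "'n::finite \<Rightarrow> real"
  assumes "i \<noteq> j"
  shows "sum f UNIV = f i + f j + sum f (UNIV - {i, j})"
proof -
  have "sum f UNIV = sum f {i, j} + sum f (UNIV - {i, j})"
    by (subst sum.subset_diff[of "{i, j}"]) auto
  then show ?thesis using assms by simp
qed

lemma rot_nth:
  assumes "i \<noteq> j"
  shows "rot i j \<theta> v $ i = v $ i * cos \<theta> - v $ j * sin \<theta>"
    and "rot i j \<theta> v $ j = v $ i * sin \<theta> + v $ j * cos \<theta>"
    and "k \<noteq> i \<Longrightarrow> k \<noteq> j \<Longrightarrow> rot i j \<theta> v $ k = v $ k"
  using assms by (auto simp: rot_def)

lemma sum_squares_rotated: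
  fixes c s x y :: real
  assumes "c\<^sup>2 + s\<^sup>2 = 1"
  shows "(x * c - y * s)\<^sup>2 + (x * s + y * c)\<^sup>2 = x\<^sup>2 + y\<^sup>2"
proof -
  have "(x * c - y * s)\<^sup>2 + (x * s + y * c)\<^sup>2 = (x\<^sup>2 + y\<^sup>2) * (c\<^sup>2 + s\<^sup>2)" by algebra
  then show ?thesis using assms by simp
qed

lemma orthogonal_transformation_rot:
  fixes i j :: "'n::finite"
  assumes ij: "i \<noteq> j"
  shows "orthogonal_transformation (rot i j \<theta> :: real ^ 'n \<Rightarrow> real ^ 'n)"
proof -
  have "linear (rot i j \<theta> :: real ^ 'n \<Rightarrow> real ^ 'n)"
    by (rule linearI) (auto simp: rot_def vec_eq_iff algebra_simps)
  moreover have "norm (rot i j \<theta> v) = norm v" for v :: "real ^ 'n"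
  proof -
    have "(\<Sum>k\<in>UNIV. (rot i j \<theta> v $ k)\<^sup>2) = (\<Sum>k\<in>UNIV. (v $ k)\<^sup>2)"
      unfolding sum_UNIV_pair[OF ij, of "\<lambda>k. (_ k)\<^sup>2"]
      using sum_squares_rotated[OF sin_cos_squared_add2, of "v $ i" \<theta> "v $ j"]
      by (simp add: rot_nth[OF ij])
    then show ?thesis by (simp add: norm_vec_def L2_set_def)
  qed
  ultimately show ?thesis by (simp add: orthogonal_transformation)
qed

lemma rot_in_sphereN: "i \<noteq> j \<Longrightarrow> v \<in> sphereN \<Longrightarrow> rot i j \<theta> v \<in> sphereN"
  for v :: "real ^ 'n::finite"
  using orthogonal_transformation_norm[OF orthogonal_transformation_rot[of i j \<theta>], of v]
  by (simp add: sphereN_def)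

lemma rot_minus_rot:
  fixes v :: "real ^ 'n::finite"
  assumes "i \<noteq> j"
  shows "rot i j (- \<theta>) (rot i j \<theta> v) = v"
proof -
  have *: "(x * c - y * s) * c + (x * s + y * c) * s = x \<and> (x * s + y * c) * c - (x * c - y * s) * s = y"
    if "c\<^sup>2 + s\<^sup>2 = 1" for x y c s :: real
    using that by (intro conjI; algebra)
  show ?thesis
    using assms *[OF sin_cos_squared_add2, where x = "v $ i" and y = "v $ j"]
    by (auto simp: rot_def vec_eq_iff)
qed

text \<open>Joint measurability in angle and point, obtained from joint continuity, is what the
  exchange of the two integrals requires.\<close>

lemma measurable_rot [measurable (raw)]:
  fixes g :: "'a \<Rightarrow> real ^ 'n::finite"
  assumes f: "f \<in> borel_measurable M" and g: "g \<in> borel_measurable M"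
  shows "(\<lambda>x. rot i j (f x) (g x)) \<in> borel_measurable M"
proof (rule borel_measurable_continuous_Pair[OF f g])
  show "continuous_on UNIV (\<lambda>p. rot i j (fst p) (snd p :: real ^ 'n))"
    unfolding rot_def
  proof (rule continuous_on_vec_lambda)
    fix k
    show "continuous_on UNIV (\<lambda>p :: real \<times> (real ^ 'n). if k = i then snd p $ i * cos (fst p) - snd p $ j * sin (fst p)
        else if k = j then snd p $ i * sin (fst p) + snd p $ j * cos (fst p) else snd p $ k)"
      by (cases "k = i"; cases "k = j") (auto intro!: continuous_intros)
  qed
qed

lemma integral_sigmaN_rot:
  fixes f :: "real ^ 'n::{finite,wellorder} \<Rightarrow> real"
  assumes "i \<noteq> j" and [measurable]: "f \<in> borel_measurable borel"
  shows "(LINT v|sigmaN. f (rot i j \<theta> v)) = (LINT v|sigmaN. f v)"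
proof -
  have "(LINT v|sigmaN. f v) = (LINT v|distr sigmaN borel (rot i j \<theta>). f v)"
    by (simp add: distr_sigmaN_orthogonal[OF orthogonal_transformation_rot[OF assms(1)]])
  also have "\<dots> = (LINT v|sigmaN. f (rot i j \<theta> v))"
    by (rule integral_distr) simp_all
  finally show ?thesis by simp
qed

section \<open>Change of the logarithm of the weight under a rotation\<close>

lemma logsum_minus_logsum_rot:
  fixes v :: "real ^ 'n::finite"
  assumes ij: "i \<noteq> j" and a: "0 < a"
  shows "logsum a v - logsum a (rot i j \<theta> v) =
    log_excess a (v $ i * cos \<theta> - v $ j * sin \<theta>) + log_excess a (v $ i * sin \<theta> + v $ j * cos \<theta>)
    - log_excess a (v $ i) - log_excess a (v $ j)"
  \<comment> \<open>Only the two rotated coordinates change, and the terms \<open>ln (1/a)\<close>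
    cancel, two against two.\<close>
  unfolding logsum_def sum_UNIV_pair[OF ij]
  by (simp add: rot_nth[OF ij] log_excess_eq[OF a])

text \<open>Expanding \<open>(1 + x\<^sup>2 / a) * (1 + y\<^sup>2 / a)\<close> leaves a nonnegative
  cross term. The bound shows that rotating two small coordinates cannot create a large
  excess.\<close>

lemma log_excess_le_add:
  assumes a: "0 < a" and t: "t\<^sup>2 \<le> x\<^sup>2 + y\<^sup>2"
  shows "log_excess a t \<le> log_excess a x + log_excess a y"
proof -
  have "t\<^sup>2 / a \<le> (x\<^sup>2 + y\<^sup>2) / a" using a t by (intro divide_right_mono) auto
  also have "\<dots> = x\<^sup>2 / a + y\<^sup>2 / a" by (simp add: add_divide_distrib)
  also have "\<dots> \<le> x\<^sup>2 / a + y\<^sup>2 / a + (x\<^sup>2 / a) * (y\<^sup>2 / a)" using a by simp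
  finally have "1 + t\<^sup>2 / a \<le> (1 + x\<^sup>2 / a) * (1 + y\<^sup>2 / a)" by (simp add: algebra_simps)
  moreover have "1 + x\<^sup>2 / a > 0" "1 + y\<^sup>2 / a > 0" "1 + t\<^sup>2 / a > 0"
    using a by (auto intro!: add_pos_nonneg)
  ultimately show ?thesis
    unfolding log_excess_def by (subst ln_mult_pos[symmetric]) (auto intro!: ln_mono)
qed

text \<open>Either \<open>x\<close> is at most \<open>m / 2\<close> in modulus, and then the
  \<open>y\<close> term keeps the combination at least \<open>m / 2\<close> in modulus; or the
  excess of \<open>x\<close> alone reaches \<open>ln (1/a) + ln ((m/2)\<^sup>2)\<close>, and the
  claimed lower bound is not positive.\<close>

lemma log_excess_combination_ge:
  fixes \<alpha> \<beta> x y :: real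
  assumes a: "0 < a" "a < 1" and y: "y\<^sup>2 \<ge> 1" and \<alpha>: "\<bar>\<alpha>\<bar> \<le> 1" and \<beta>: "m \<le> \<bar>\<beta>\<bar>" and m: "0 < m"
  shows "log_excess a (\<alpha> * x + \<beta> * y) \<ge> ln (1/a) - log_excess a x + ln ((m/2)\<^sup>2)"
proof (cases "\<bar>x\<bar> \<le> m / 2")
  case True
  have "\<bar>y\<bar> \<ge> 1" using y by (simp add: abs_le_square_iff[of 1 y, simplified])
  then have "m * 1 \<le> \<bar>\<beta>\<bar> * \<bar>y\<bar>" using \<beta> m by (intro mult_mono) auto
  moreover have "\<bar>\<alpha>\<bar> * \<bar>x\<bar> \<le> 1 * (m/2)" using True \<alpha> m by (intro mult_mono) auto
  ultimately have "m / 2 \<le> \<bar>\<alpha> * x + \<beta> * y\<bar>"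
    unfolding abs_mult[symmetric] by linarith
  then have "(m/2)\<^sup>2 \<le> (\<alpha> * x + \<beta> * y)\<^sup>2"
    using m by (metis abs_le_square_iff abs_of_pos half_gt_zero)
  then have "log_excess a (\<alpha> * x + \<beta> * y) \<ge> ln ((m/2)\<^sup>2) + ln (1/a)"
    using a m by (intro log_excess_ge) auto
  then show ?thesis using log_excess_nonneg[OF a(1), of x] by linarith
next
  case False
  then have "(m/2)\<^sup>2 \<le> x\<^sup>2"
    using m by (metis abs_le_square_iff abs_of_pos half_gt_zero less_imp_le not_le)
  then have "log_excess a x \<ge> ln ((m/2)\<^sup>2) + ln (1/a)"
    using a m by (intro log_excess_ge) auto
  then show ?thesis using log_excess_nonneg[OF a(1), of "\<alpha> * x + \<beta> * y"] by linarith
qed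

text \<open>Both combinations inherit the size of \<open>y\<close>, so the excesses total two units
  of \<open>ln (1/a)\<close> afterwards against one before. The factor 3 collects one
  \<open>log_excess a x\<close> from each of the two lower bounds and one from the subtracted term.
  General coefficients allow either coordinate of the pair to be the large one.\<close>

lemma log_excess_rotated_pair:
  fixes x y :: real
  assumes a: "0 < a" "a < 1" and y: "y\<^sup>2 \<ge> 1" and n: "x\<^sup>2 + y\<^sup>2 \<le> n" and m: "0 < m" "m \<le> 1"
    and \<alpha>: "\<bar>\<alpha>1\<bar> \<le> 1" "\<bar>\<alpha>2\<bar> \<le> 1" and \<beta>: "m \<le> \<bar>\<beta>1\<bar>" "m \<le> \<bar>\<beta>2\<bar>"
    and w: "(\<alpha>1 * x + \<beta>1 * y)\<^sup>2 + (\<alpha>2 * x + \<beta>2 * y)\<^sup>2 = x\<^sup>2 + y\<^sup>2"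
  shows "\<bar>log_excess a (\<alpha>1 * x + \<beta>1 * y) + log_excess a (\<alpha>2 * x + \<beta>2 * y)
      - log_excess a x - log_excess a y - ln (1/a)\<bar>
    \<le> 3 * log_excess a x + 2 * (ln (1 + n) - ln ((m/2)\<^sup>2))"
proof -
  let ?w1 = "\<alpha>1 * x + \<beta>1 * y" and ?w2 = "\<alpha>2 * x + \<beta>2 * y"
  have "?w1\<^sup>2 \<le> n" "?w2\<^sup>2 \<le> n" "y\<^sup>2 \<le> n"
    using w n zero_le_power2[of ?w1] zero_le_power2[of ?w2] zero_le_power2[of x] by linarith+
  then have up: "log_excess a ?w1 \<le> ln (1 + n) + ln (1/a)" "log_excess a ?w2 \<le> ln (1 + n) + ln (1/a)"
    "log_excess a y \<le> ln (1 + n) + ln (1/a)"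
    using a by (simp_all only: log_excess_le)
  have low: "log_excess a ?w1 \<ge> ln (1/a) - log_excess a x + ln ((m/2)\<^sup>2)"
    "log_excess a ?w2 \<ge> ln (1/a) - log_excess a x + ln ((m/2)\<^sup>2)"
    using a y \<alpha> \<beta> m by (simp_all only: log_excess_combination_ge)
  have "log_excess a y \<ge> ln 1 + ln (1/a)"
    using a y by (intro log_excess_ge) auto
  then have y': "log_excess a y \<ge> ln (1/a)" by simp
  have x': "log_excess a x \<ge> 0" using a by (simp add: log_excess_nonneg)
  have "(m/2)\<^sup>2 \<le> 1" using m by (intro power_le_one) auto
  then have "ln ((m/2)\<^sup>2) \<le> 0" using m by simp
  moreover have "n \<ge> 0" using n y zero_le_power2[of x] by linarith
  then have "ln (1 + n) \<ge> 0" by simp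
  ultimately show ?thesis using up low y' x' by (smt (verit))
qed

text \<open>The bound \<open>m\<close> on sine and cosine ensures that a large coordinate inside the
  pair passes a fixed fraction of its size to both rotated coordinates. A pair avoiding
  \<open>k\<close> contributes at most the defect, by subadditivity of the excess.\<close>

lemma logsum_rot_estimate:
  fixes v :: "real ^ 'n::finite"
  assumes a: "0 < a" "a < 1" and v: "v \<in> sphereN" and ij: "i \<noteq> j" and k: "(v $ k)\<^sup>2 \<ge> 1"
    and m: "0 < m" "m \<le> \<bar>sin \<theta>\<bar>" "m \<le> \<bar>cos \<theta>\<bar>"
  shows "\<bar>logsum a v - logsum a (rot i j \<theta> v) - (if k = i \<or> k = j then ln (1/a) else 0)\<bar>
    \<le> 3 * defect a v + 2 * (ln (1 + real CARD('n)) - ln ((m/2)\<^sup>2))"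
proof -
  let ?A = "log_excess a" and ?C = "2 * (ln (1 + real CARD('n)) - ln ((m/2)\<^sup>2))"
  define w1 where "w1 = v $ i * cos \<theta> - v $ j * sin \<theta>"
  define w2 where "w2 = v $ i * sin \<theta> + v $ j * cos \<theta>"
  have W: "logsum a v - logsum a (rot i j \<theta> v) = ?A w1 + ?A w2 - ?A (v $ i) - ?A (v $ j)"
    unfolding w1_def w2_def by (rule logsum_minus_logsum_rot[OF ij a(1)])
  have sq: "w1\<^sup>2 + w2\<^sup>2 = (v $ i)\<^sup>2 + (v $ j)\<^sup>2"
    unfolding w1_def w2_def by (rule sum_squares_rotated) simp
  have n: "(v $ i)\<^sup>2 + (v $ j)\<^sup>2 \<le> real CARD('n)"
    using v sum_UNIV_pair[OF ij, of "\<lambda>k. (v $ k)\<^sup>2"]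
      sum_nonneg[of "UNIV - {i, j}" "\<lambda>k. (v $ k)\<^sup>2"] by (simp add: sphereN_sum)
  have sub: "sum (\<lambda>l. ?A (v $ l)) X \<le> defect a v" if "X \<subseteq> UNIV - {k}" for X
  proof -
    have "sum (\<lambda>l. ?A (v $ l)) X \<le> (\<Sum>l\<in>UNIV - {k}. ?A (v $ l))"
      using that a by (intro sum_mono2) (auto intro: log_excess_nonneg)
    then show ?thesis using sum_log_excess_le_defect[OF a(1) k] by linarith
  qed
  have m1: "m \<le> 1" using m abs_sin_le_one[of \<theta>] by linarith
  consider "k = j" | "k = i" | "k \<noteq> i" "k \<noteq> j" by blast
  then show ?thesis
  proof cases
    case 1
    have e: "cos \<theta> * v $ i + (- sin \<theta>) * v $ j = w1" "sin \<theta> * v $ i + cos \<theta> * v $ j = w2"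
      by (simp_all add: w1_def w2_def)
    have "\<bar>?A (cos \<theta> * v $ i + (- sin \<theta>) * v $ j) + ?A (sin \<theta> * v $ i + cos \<theta> * v $ j)
        - ?A (v $ i) - ?A (v $ j) - ln (1/a)\<bar> \<le> 3 * ?A (v $ i) + ?C"
      by (rule log_excess_rotated_pair) (unfold e, use a k 1 n m m1 sq in auto)
    then have "\<bar>?A w1 + ?A w2 - ?A (v $ i) - ?A (v $ j) - ln (1/a)\<bar> \<le> 3 * ?A (v $ i) + ?C"
      unfolding e .
    moreover have "?A (v $ i) \<le> defect a v" using sub[of "{i}"] 1 ij by simp
    ultimately show ?thesis unfolding W using 1 by simp
  next
    case 2
    have e: "(- sin \<theta>) * v $ j + cos \<theta> * v $ i = w1" "cos \<theta> * v $ j + sin \<theta> * v $ i = w2"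
      by (simp_all add: w1_def w2_def)
    have "\<bar>?A ((- sin \<theta>) * v $ j + cos \<theta> * v $ i) + ?A (cos \<theta> * v $ j + sin \<theta> * v $ i)
        - ?A (v $ j) - ?A (v $ i) - ln (1/a)\<bar> \<le> 3 * ?A (v $ j) + ?C"
      by (rule log_excess_rotated_pair) (unfold e, use a k 2 n m m1 sq in auto)
    then have "\<bar>?A w1 + ?A w2 - ?A (v $ j) - ?A (v $ i) - ln (1/a)\<bar> \<le> 3 * ?A (v $ j) + ?C"
      unfolding e .
    moreover have "?A (v $ j) \<le> defect a v" using sub[of "{j}"] 2 ij by simp
    moreover have "?A w1 + ?A w2 - ?A (v $ i) - ?A (v $ j) = ?A w1 + ?A w2 - ?A (v $ j) - ?A (v $ i)"
      by simp
    ultimately show ?thesis unfolding W using 2 by simp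
  next
    \<comment> \<open>Each rotated excess is at most the sum of the two old ones, so the change lies
      between minus and plus that sum, which the defect bounds.\<close>
    case 3
    have "w1\<^sup>2 \<le> (v $ i)\<^sup>2 + (v $ j)\<^sup>2" "w2\<^sup>2 \<le> (v $ i)\<^sup>2 + (v $ j)\<^sup>2"
      using sq zero_le_power2[of w1] zero_le_power2[of w2] by linarith+
    then have "?A w1 \<le> ?A (v $ i) + ?A (v $ j)" "?A w2 \<le> ?A (v $ i) + ?A (v $ j)"
      using a by (simp_all only: log_excess_le_add)
    moreover have "0 \<le> ?A t" for t using a by (simp add: log_excess_nonneg)
    note this[of w1] this[of w2] this[of "v $ i"] this[of "v $ j"]
    moreover have "?A (v $ i) + ?A (v $ j) \<le> defect a v" using sub[of "{i, j}"] 3 ij by simp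
    moreover have "(m/2)\<^sup>2 \<le> 1" using m m1 by (intro power_le_one) auto
    then have "ln ((m/2)\<^sup>2) \<le> 0" using m by simp
    moreover have "ln (1 + real CARD('n)) \<ge> 0" by simp
    ultimately show ?thesis unfolding W using 3 by (smt (verit))
  qed
qed

text \<open>The ordered pairs containing \<open>k\<close> correspond to the N - 1 other indices
  \<open>l\<close> through \<open>(min k l, max k l)\<close>.\<close>

lemma sum_pairs_containing:
  fixes k :: "'n::{finite,wellorder}" and c :: real
  shows "(\<Sum>(i, j) | i < j. if k = i \<or> k = j then c else 0) = (real CARD('n) - 1) * c"
proof -
  let ?f = "\<lambda>l. (min k l, max k l)"
  have "(\<Sum>(i, j) | i < j. if k = i \<or> k = j then c else 0)
      = (\<Sum>p\<in>{(i, j). i < j}. if k = fst p \<or> k = snd p then c else 0)"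
    by (rule sum.cong) auto
  also have "\<dots> = (\<Sum>p\<in>{(i, j). i < j} \<inter> {p. k = fst p \<or> k = snd p}. c)"
    by (subst sum.inter_restrict) (auto intro!: sum.cong)
  also have "{(i, j). i < j} \<inter> {p. k = fst p \<or> k = snd p} = ?f ` (UNIV - {k})"
  proof (intro equalityI subsetI)
    fix p assume "p \<in> {(i, j). i < j} \<inter> {p. k = fst p \<or> k = snd p}"
    then obtain i j where p: "p = (i, j)" "i < j" "k = i \<or> k = j" by (cases p) auto
    then show "p \<in> ?f ` (UNIV - {k})"
      by (cases "k = i") (auto simp: min_def max_def intro!: image_eqI[of _ _ "if k = i then j else i"])
  next
    fix p assume "p \<in> ?f ` (UNIV - {k})"
    then obtain l where "l \<noteq> k" "p = ?f l" by auto
    then show "p \<in> {(i, j). i < j} \<inter> {p. k = fst p \<or> k = snd p}"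
      by (cases k l rule: linorder_cases) (auto simp: min_def max_def)
  qed
  also have "(\<Sum>p\<in>?f ` (UNIV - {k}). c) = (\<Sum>l\<in>UNIV - {k}. c)"
    by (subst sum.reindex) (auto simp: inj_on_def min_def max_def split: if_splits)
  finally show ?thesis by (simp add: of_nat_diff)
qed

text \<open>Which coordinate is large depends on \<open>v\<close>, but every choice of
  \<open>k\<close> lies in exactly N - 1 pairs. After summation over pairs the leading term no
  longer depends on \<open>v\<close>.\<close>

lemma sum_logsum_rot_estimate:
  fixes v :: "real ^ 'n::{finite,wellorder}"
  assumes a: "0 < a" "a < 1" and v: "v \<in> sphereN"
    and m: "0 < m" "m \<le> \<bar>sin \<theta>\<bar>" "m \<le> \<bar>cos \<theta>\<bar>"
  shows "\<bar>(\<Sum>(i, j) | i < j. logsum a v - logsum a (rot i j \<theta> v)) - (real CARD('n) - 1) * ln (1/a)\<bar>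
    \<le> real (card {(i :: 'n, j). i < j}) * (3 * defect a v + 2 * (ln (1 + real CARD('n)) - ln ((m/2)\<^sup>2)))"
proof -
  obtain k where k: "(v $ k)\<^sup>2 \<ge> 1" using sphereN_large_coordinate[OF v] .
  have "(\<Sum>(i, j) | i < j. logsum a v - logsum a (rot i j \<theta> v)) - (real CARD('n) - 1) * ln (1/a)
      = (\<Sum>(i, j) | i < j. logsum a v - logsum a (rot i j \<theta> v) - (if k = i \<or> k = j then ln (1/a) else 0))"
    unfolding sum_pairs_containing[of k, symmetric] sum_subtractf[symmetric] by (simp add: split_beta)
  also have "\<bar>\<dots>\<bar> \<le> (\<Sum>(i, j) | i < j. \<bar>logsum a v - logsum a (rot i j \<theta> v) - (if k = i \<or> k = j then ln (1/a) else 0)\<bar>)"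
    using sum_abs[of "\<lambda>(i, j). logsum a v - logsum a (rot i j \<theta> v) - (if k = i \<or> k = j then ln (1/a) else 0)"]
    by (simp add: split_beta)
  also have "\<dots> \<le> (\<Sum>p\<in>{(i :: 'n, j). i < j}. 3 * defect a v + 2 * (ln (1 + real CARD('n)) - ln ((m/2)\<^sup>2)))"
  proof (rule sum_mono)
    fix p :: "'n \<times> 'n" assume "p \<in> {(i, j). i < j}"
    then show "(case p of (i, j) \<Rightarrow> \<bar>logsum a v - logsum a (rot i j \<theta> v) - (if k = i \<or> k = j then ln (1/a) else 0)\<bar>)
        \<le> 3 * defect a v + 2 * (ln (1 + real CARD('n)) - ln ((m/2)\<^sup>2))"
      using logsum_rot_estimate[OF a v _ k m, of "fst p" "snd p"]
      by (auto simp only: case_prod_beta mem_Collect_eq less_imp_neq simp_thms)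
  qed
  finally show ?thesis by simp
qed

section \<open>The dissipation\<close>

text \<open>The integral over the sphere is taken first, at a fixed angle; the factor
  \<open>1 / (2 * pi)\<close> is left to \<open>uniform_angle\<close>.\<close>

definition dissipation_at :: "(real ^ 'n \<Rightarrow> real) \<Rightarrow> 'n \<Rightarrow> 'n \<Rightarrow> real \<Rightarrow> real" where
  "dissipation_at F i j \<theta> =
    (LINT v|sigmaN. (F v - F (rot i j \<theta> v)) * (ln (F v) - ln (F (rot i j \<theta> v))))"

definition uniform_angle :: "real measure" where
  "uniform_angle = density lborel (\<lambda>\<theta>. ennreal (indicator {0..2 * pi} \<theta> / (2 * pi)))"

lemma sets_uniform_angle [simp, measurable_cong]: "sets uniform_angle = sets borel"
  and space_uniform_angle [simp]: "space uniform_angle = UNIV"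
  by (simp_all add: uniform_angle_def)

lemma prob_space_uniform_angle: "prob_space uniform_angle"
proof
  have "emeasure uniform_angle (space uniform_angle)
      = (\<integral>\<^sup>+\<theta>. ennreal (1 / (2 * pi)) * indicator {0..2 * pi} \<theta> \<partial>lborel)"
    unfolding uniform_angle_def
    by (simp add: emeasure_density) (intro nn_integral_cong, simp add: indicator_def)
  also have "\<dots> = ennreal (1 / (2 * pi)) * ennreal (2 * pi)"
    by (subst nn_integral_cmult) auto
  also have "\<dots> = 1"
    by (subst ennreal_mult'[symmetric]) auto
  finally show "emeasure uniform_angle (space uniform_angle) = 1" .
qed

lemma integral_uniform_angle:
  fixes f :: "real \<Rightarrow> real"
  assumes [measurable]: "f \<in> borel_measurable borel"
  shows "(LINT \<theta>|uniform_angle. f \<theta>) = (LINT \<theta>:{0..2 * pi}|lborel. f \<theta> / (2 * pi))"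
  unfolding uniform_angle_def set_lebesgue_integral_def
  by (subst integral_density) (auto intro!: Bochner_Integration.integral_cong)

text \<open>The exceptional angles are zeros of \<open>sin (2 * \<theta>)\<close>, hence countably
  many.\<close>

lemma AE_uniform_angle_sin_cos: "AE \<theta> in uniform_angle. sin \<theta> \<noteq> 0 \<and> cos \<theta> \<noteq> 0"
proof -
  have "{\<theta>. sin \<theta> = 0 \<or> cos \<theta> = 0} \<subseteq> range (\<lambda>i::int. of_int i * (pi / 2))"
  proof
    fix \<theta> :: real assume "\<theta> \<in> {\<theta>. sin \<theta> = 0 \<or> cos \<theta> = 0}"
    then have "sin (2 * \<theta>) = 0" by (auto simp: sin_double)
    then obtain i :: int where "2 * \<theta> = of_int i * pi" by (auto simp: sin_zero_iff_int2)
    then have "\<theta> = of_int i * (pi / 2)" by simp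
    then show "\<theta> \<in> range (\<lambda>i::int. of_int i * (pi / 2))" by blast
  qed
  then have "countable {\<theta>::real. sin \<theta> = 0 \<or> cos \<theta> = 0}"
    by (rule countable_subset) simp
  then have "{\<theta>::real. sin \<theta> = 0 \<or> cos \<theta> = 0} \<in> null_sets lborel"
    by (rule countable_imp_null_set_lborel)
  then have "AE \<theta> in lborel. sin \<theta> \<noteq> 0 \<and> cos \<theta> \<noteq> (0::real)"
    by (rule AE_I') auto
  then show ?thesis
    unfolding uniform_angle_def by (subst AE_density) auto
qed

lemma measurable_F_aq [measurable]: "F_aq a q \<in> borel_measurable (borel :: (real^'n) measure)"
  unfolding F_aq_def by measurable

lemma measurable_dissipation_at [measurable]:
  fixes F :: "real ^ 'n::finite \<Rightarrow> real"
  assumes [measurable]: "F \<in> borel_measurable borel"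
  shows "dissipation_at F i j \<in> borel_measurable borel"
proof -
  interpret prob_space "sigmaN :: (real ^ 'n) measure" by (rule prob_space_sigmaN)
  show ?thesis
    unfolding dissipation_at_def by measurable
qed

lemma abs_logsum_diff_rot_le:
  fixes v :: "real ^ 'n::finite"
  assumes "0 < a" "a < 1" "v \<in> sphereN" "i \<noteq> j"
  shows "\<bar>logsum a v - logsum a (rot i j \<theta> v)\<bar> \<le> 2 * (real CARD('n) * (ln (1/a) + ln (1 + real CARD('n))))"
  using abs_logsum_le[OF assms(1-3)] abs_logsum_le[OF assms(1,2) rot_in_sphereN[OF assms(4,3)], of \<theta>]
  by linarith

lemma integrable_G_aq_logsum_rot:
  assumes "0 < a" "a < 1" "q > 0" "i \<noteq> (j :: 'n::finite)"
  shows "integrable sigmaN (\<lambda>v. G_aq a q v * (logsum a v - logsum a (rot i j \<theta> v)))"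
  by (rule integrable_G_aq_mult[OF assms(1-3)]) (use abs_logsum_diff_rot_le assms in auto)

text \<open>The substitution \<open>v \<mapsto> rot i j (- \<theta>) v\<close>, which preserves the measure, moves all rotations
  from the weight \<open>G_aq\<close> to its logarithm.\<close>
lemma dissipation_at_F_aq:
  fixes i j :: "'n::{finite,wellorder}"
  assumes q: "q > 1/2" and a: "0 < a" "a < 1" and ij: "i \<noteq> j"
  shows "dissipation_at (F_aq a q :: real ^ 'n::_ \<Rightarrow> real) i j \<theta> = q / Z_aq TYPE('n) a q *
    ((LINT v|sigmaN. G_aq a q v * (logsum a v - logsum a (rot i j \<theta> v)))
     + (LINT v|sigmaN. G_aq a q v * (logsum a v - logsum a (rot i j (- \<theta>) v))))"
proof -
  let ?Z = "Z_aq TYPE('n) a q" and ?G = "G_aq a q :: real ^ 'n::_ \<Rightarrow> real"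
  have q0: "q > 0" using q by simp
  let ?f = "\<lambda>v. ?G v * (logsum a v - logsum a (rot i j \<theta> v))"
  let ?g = "\<lambda>v. ?G v * (logsum a v - logsum a (rot i j (- \<theta>) v))"
  have int: "integrable sigmaN ?f" by (rule integrable_G_aq_logsum_rot[OF a q0 ij])
  have bnd: "\<bar>logsum a v - logsum a (rot i j (- \<theta>) v)\<bar> \<le> 2 * (real CARD('n) * (ln (1/a) + ln (1 + real CARD('n))))"
    if "v \<in> sphereN" for v :: "real ^ 'n::_"
    by (rule abs_logsum_diff_rot_le[OF a that ij])
  have "integrable (distr sigmaN borel (rot i j \<theta>)) ?g"
    unfolding distr_sigmaN_orthogonal[OF orthogonal_transformation_rot[OF ij]]
    by (rule integrable_G_aq_logsum_rot[OF a q0 ij])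
  then have int': "integrable sigmaN (\<lambda>v. ?g (rot i j \<theta> v))"
    by (subst (asm) integrable_distr_eq) auto
  \<comment> \<open>The product of differences is split into its \<open>F v\<close> part and its
    \<open>F (rot i j \<theta> v)\<close> part. In the latter, \<open>v\<close> is written as the
    inverse rotation of \<open>rot i j \<theta> v\<close>, so that it becomes a function of the
    rotated point alone.\<close>
  have "(F_aq a q v - F_aq a q (rot i j \<theta> v)) * (ln (F_aq a q v) - ln (F_aq a q (rot i j \<theta> v)))
      = q / ?Z * (?f v + ?g (rot i j \<theta> v))" for v :: "real ^ 'n::_"
    unfolding ln_F_aq[OF q a] rot_minus_rot[OF ij] using Z_aq_pos[OF q a, where 'n='n]
    by (simp add: F_aq_def field_simps)
  then have "dissipation_at (F_aq a q) i j \<theta> = q / ?Z * (LINT v|sigmaN. ?f v + ?g (rot i j \<theta> v))"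
    unfolding dissipation_at_def by simp
  also have "(LINT v|sigmaN. ?f v + ?g (rot i j \<theta> v)) = (LINT v|sigmaN. ?f v) + (LINT v|sigmaN. ?g (rot i j \<theta> v))"
    by (rule Bochner_Integration.integral_add[OF int int'])
  also have "(LINT v|sigmaN. ?g (rot i j \<theta> v)) = (LINT v|sigmaN. ?g v)"
    by (rule integral_sigmaN_rot[OF ij]) measurable
  finally show ?thesis .
qed

text \<open>The pointwise estimate is integrated against the weight: the defect contributes through
  \<open>K\<close>, the constant through the normalising constant.\<close>

lemma abs_sum_G_aq_logsum_rot_le:
  fixes \<theta> :: real
  assumes q: "q > 1/2" and a: "0 < a" "a < 1"
    and m: "0 < m" "m \<le> \<bar>sin \<theta>\<bar>" "m \<le> \<bar>cos \<theta>\<bar>"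
    and K: "(LINT v|sigmaN. G_aq a q v * defect a (v :: real ^ 'n::{finite,wellorder})) \<le> K * Z_aq TYPE('n::_) a q"
  shows "\<bar>(\<Sum>(i, j) | i < j. LINT v|sigmaN. G_aq a q v * (logsum a v - logsum a (rot i j \<theta> (v :: real ^ 'n::_))))
      - (real CARD('n::_) - 1) * ln (1/a) * Z_aq TYPE('n::_) a q\<bar>
    \<le> real (card {(i :: 'n::_, j). i < j}) * (3 * K + 2 * (ln (1 + real CARD('n::_)) - ln ((m/2)\<^sup>2))) * Z_aq TYPE('n::_) a q"
proof -
  let ?S = "sigmaN :: (real ^ 'n::_) measure" and ?Z = "Z_aq TYPE('n::_) a q"
  let ?P = "{(i :: 'n::_, j). i < j}" and ?G = "G_aq a q :: real ^ 'n::_ \<Rightarrow> real"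
  define L where "L = (real CARD('n::_) - 1) * ln (1/a)"
  define c where "c = 2 * (ln (1 + real CARD('n::_)) - ln ((m/2)\<^sup>2))"
  define W where "W p v = logsum a v - logsum a (rot (fst p) (snd p) \<theta> v)" for p and v :: "real ^ 'n::_"
  have q0: "q > 0" using q by simp
  have intG: "integrable ?S ?G" by (rule integrable_G_aq[OF a q0])
  have intW: "integrable ?S (\<lambda>v. ?G v * W p v)" if "p \<in> ?P" for p
    unfolding W_def using that by (intro integrable_G_aq_logsum_rot a q0) auto
  have int: "integrable ?S (\<lambda>v. (\<Sum>p\<in>?P. ?G v * W p v) - L * ?G v)"
    by (intro Bochner_Integration.integrable_diff Bochner_Integration.integrable_sum intW integrable_mult_right intG)
  have intD: "integrable ?S (\<lambda>v. real (card ?P) * (3 * (?G v * defect a v) + c * ?G v))"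
    by (intro integrable_mult_right Bochner_Integration.integrable_add intG integrable_G_aq_defect a q0)
  have "(\<Sum>(i, j) | i < j. LINT v|?S. ?G v * (logsum a v - logsum a (rot i j \<theta> v)))
      = (\<Sum>p\<in>?P. LINT v|?S. ?G v * W p v)"
    by (intro sum.cong) (auto simp: W_def)
  also have "\<dots> = (LINT v|?S. (\<Sum>p\<in>?P. ?G v * W p v))"
    by (rule Bochner_Integration.integral_sum[symmetric]) (rule intW)
  also have "\<dots> - L * ?Z = (LINT v|?S. (\<Sum>p\<in>?P. ?G v * W p v) - L * ?G v)"
    unfolding Z_aq_def using intG
    by (subst Bochner_Integration.integral_diff) (auto intro!: Bochner_Integration.integrable_sum intW)
  finally have eq: "(\<Sum>(i, j) | i < j. LINT v|?S. ?G v * (logsum a v - logsum a (rot i j \<theta> v))) - L * ?Z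
      = (LINT v|?S. (\<Sum>p\<in>?P. ?G v * W p v) - L * ?G v)" .
  have "\<bar>LINT v|?S. (\<Sum>p\<in>?P. ?G v * W p v) - L * ?G v\<bar>
      \<le> (LINT v|?S. \<bar>(\<Sum>p\<in>?P. ?G v * W p v) - L * ?G v\<bar>)"
    by (rule integral_abs_bound)
  also have "\<dots> \<le> (LINT v|?S. real (card ?P) * (3 * (?G v * defect a v) + c * ?G v))"
  proof (rule integral_sigmaN_mono[OF integrable_abs[OF int] intD])
    fix v :: "real ^ 'n::_" assume v: "v \<in> sphereN"
    have "(\<Sum>p\<in>?P. W p v) = (\<Sum>(i, j) | i < j. logsum a v - logsum a (rot i j \<theta> v))"
      by (intro sum.cong) (auto simp: W_def)
    then have W: "\<bar>(\<Sum>p\<in>?P. W p v) - L\<bar> \<le> real (card ?P) * (3 * defect a v + c)"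
      using sum_logsum_rot_estimate[OF a v m] by (simp add: L_def c_def)
    have G0: "?G v \<ge> 0" using a by (simp add: G_aq_eq_exp)
    have "\<bar>(\<Sum>p\<in>?P. ?G v * W p v) - L * ?G v\<bar> = ?G v * \<bar>(\<Sum>p\<in>?P. W p v) - L\<bar>"
    proof -
      have "(\<Sum>p\<in>?P. ?G v * W p v) - L * ?G v = ?G v * ((\<Sum>p\<in>?P. W p v) - L)"
        by (simp add: sum_distrib_left right_diff_distrib mult.commute)
      then show ?thesis by (simp only: abs_mult abs_of_nonneg[OF G0])
    qed
    also have "\<dots> \<le> ?G v * (real (card ?P) * (3 * defect a v + c))"
      by (rule mult_left_mono[OF W G0])
    also have "\<dots> = real (card ?P) * (3 * (?G v * defect a v) + c * ?G v)"
      by (simp add: algebra_simps)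
    finally show "\<bar>(\<Sum>p\<in>?P. ?G v * W p v) - L * ?G v\<bar> \<le> real (card ?P) * (3 * (?G v * defect a v) + c * ?G v)" .
  qed
  also have "\<dots> = real (card ?P) * (3 * (LINT v|?S. ?G v * defect a v) + c * ?Z)"
    unfolding Z_aq_def using intG integrable_G_aq_defect[OF a q0, where 'n="'n::_"] by simp
  also have "\<dots> \<le> real (card ?P) * (3 * (K * ?Z) + c * ?Z)"
    using K by (intro mult_left_mono) (linarith, simp)
  also have "\<dots> = real (card ?P) * (3 * K + c) * ?Z" by (simp add: algebra_simps)
  finally show ?thesis unfolding eq[unfolded L_def] L_def c_def .
qed

text \<open>The angles \<open>\<theta>\<close> and \<open>- \<theta>\<close> each contribute
  \<open>(N - 1) * ln (1/a)\<close>, whence the factor 2. The bound may depend on the angle: the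
  constant obtained involves \<open>ln m\<close> and degenerates as sine or cosine tends to
  0.\<close>

lemma sum_dissipation_at_asymp:
  fixes \<theta> :: real
  assumes q: "q > 1/2" and \<theta>: "sin \<theta> \<noteq> 0" "cos \<theta> \<noteq> 0"
  obtains K where "\<And>a. 0 < a \<Longrightarrow> a < 1 \<Longrightarrow>
    \<bar>(\<Sum>(i, j) | i < j. dissipation_at (F_aq a q :: real ^ 'n::{finite,wellorder} \<Rightarrow> real) i j \<theta>)
      - 2 * q * (real CARD('n::_) - 1) * ln (1/a)\<bar> \<le> K"
proof -
  obtain K where K: "\<And>a. 0 < a \<Longrightarrow> a < 1 \<Longrightarrow>
    (LINT v|(sigmaN :: (real^'n::_) measure). G_aq a q v * defect a v) \<in> {0..K * Z_aq TYPE('n::_) a q}"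
    using integral_G_aq_defect[OF q, where 'n="'n::_"] by blast
  define m where "m = min \<bar>sin \<theta>\<bar> \<bar>cos \<theta>\<bar>"
  have m: "0 < m" "m \<le> \<bar>sin \<theta>\<bar>" "m \<le> \<bar>cos \<theta>\<bar>" using \<theta> by (auto simp: m_def)
  \<comment> \<open>Sine and cosine keep their moduli at the opposite angle, so one \<open>m\<close>
    serves both.\<close>
  have m': "m \<le> \<bar>sin (- \<theta>)\<bar>" "m \<le> \<bar>cos (- \<theta>)\<bar>" using m by auto
  define B where "B = real (card {(i :: 'n::_, j). i < j}) * (3 * K + 2 * (ln (1 + real CARD('n::_)) - ln ((m/2)\<^sup>2)))"
  show thesis
  proof
    fix a :: real assume a: "0 < a" "a < 1"
    let ?Z = "Z_aq TYPE('n::_) a q"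
    have Z: "?Z > 0" by (rule Z_aq_pos[OF q a])
    define L where "L = (real CARD('n::_) - 1) * ln (1/a)"
    define I where "I \<theta> = (\<Sum>(i, j) | i < j. LINT v|sigmaN. G_aq a q v * (logsum a v - logsum a (rot i j \<theta> (v :: real ^ 'n::_))))" for \<theta>
    have K': "(LINT v|(sigmaN :: (real^'n::_) measure). G_aq a q v * defect a v) \<le> K * ?Z"
      using K[OF a] by simp
    have b: "\<bar>I \<theta> - L * ?Z\<bar> \<le> B * ?Z" "\<bar>I (- \<theta>) - L * ?Z\<bar> \<le> B * ?Z"
      unfolding I_def L_def B_def
      by (rule abs_sum_G_aq_logsum_rot_le[OF q a m(1) _ _ K'], fact, fact)+
    have "(\<Sum>(i, j) | i < j. dissipation_at (F_aq a q :: real ^ 'n::_ \<Rightarrow> real) i j \<theta>) = q / ?Z * (I \<theta> + I (- \<theta>))"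
      unfolding I_def sum.distrib[symmetric] sum_distrib_left
      by (intro sum.cong) (auto simp: dissipation_at_F_aq[OF q a] less_imp_neq)
    then have "(\<Sum>(i, j) | i < j. dissipation_at (F_aq a q :: real ^ 'n::_ \<Rightarrow> real) i j \<theta>) - 2 * q * L
        = q / ?Z * ((I \<theta> - L * ?Z) + (I (- \<theta>) - L * ?Z))"
      using Z by (simp add: field_simps)
    also have "\<bar>\<dots>\<bar> = q / ?Z * \<bar>(I \<theta> - L * ?Z) + (I (- \<theta>) - L * ?Z)\<bar>"
      using Z q by (simp add: abs_mult)
    also have "\<dots> \<le> q / ?Z * (2 * B * ?Z)"
      using Z q b by (intro mult_left_mono) (linarith, simp)
    also have "\<dots> = 2 * q * B" using Z by simp
    finally show "\<bar>(\<Sum>(i, j) | i < j. dissipation_at (F_aq a q :: real ^ 'n::_ \<Rightarrow> real) i j \<theta>)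
      - 2 * q * (real CARD('n::_) - 1) * ln (1/a)\<bar> \<le> 2 * q * B"
      by (simp add: L_def mult.assoc)
  qed
qed

text \<open>Unlike the asymptotic estimate this bound is uniform in the angle, at the cost of a
  cruder constant; divided by \<open>ln (1/a)\<close> it gives the dominating function. The 4 comes
  from two opposite angles and two values of \<open>logsum\<close>.\<close>

lemma abs_sum_dissipation_at_le:
  fixes \<theta> :: real
  assumes q: "q > 1/2" and a: "0 < a" "a < 1"
  shows "\<bar>\<Sum>(i, j) | i < j. dissipation_at (F_aq a q :: real ^ 'n::{finite,wellorder} \<Rightarrow> real) i j \<theta>\<bar>
    \<le> real (card {(i :: 'n::_, j). i < j}) * (4 * q * real CARD('n::_)) * (ln (1/a) + ln (1 + real CARD('n::_)))"
proof -
  let ?Z = "Z_aq TYPE('n::_) a q" and ?P = "{(i :: 'n::_, j). i < j}"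
  define B where "B = 2 * (real CARD('n::_) * (ln (1/a) + ln (1 + real CARD('n::_))))"
  have Z: "?Z > 0" by (rule Z_aq_pos[OF q a])
  have q0: "q > 0" using q by simp
  have I: "\<bar>LINT v|sigmaN. G_aq a q v * (logsum a v - logsum a (rot i j \<theta> (v :: real ^ 'n::_)))\<bar> \<le> B * ?Z"
    if ij: "i \<noteq> j" for i j :: "'n::_" and \<theta>
  proof -
    note int = integrable_G_aq_logsum_rot[OF a q0 ij, of \<theta>]
    have "\<bar>LINT v|sigmaN. G_aq a q v * (logsum a v - logsum a (rot i j \<theta> (v :: real ^ 'n::_)))\<bar>
        \<le> (LINT v|sigmaN. \<bar>G_aq a q v * (logsum a v - logsum a (rot i j \<theta> (v :: real ^ 'n::_)))\<bar>)"
      by (rule integral_abs_bound)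
    also have "\<dots> \<le> (LINT v|(sigmaN :: (real ^ 'n::_) measure). G_aq a q v * B)"
    proof (rule integral_sigmaN_mono[OF integrable_abs[OF int]])
      show "integrable sigmaN (\<lambda>v :: real ^ 'n::_. G_aq a q v * B)"
        using integrable_G_aq[OF a q0, where 'n="'n::_"] by simp
      fix v :: "real ^ 'n::_" assume v: "v \<in> sphereN"
      show "\<bar>G_aq a q v * (logsum a v - logsum a (rot i j \<theta> v))\<bar> \<le> G_aq a q v * B"
        using abs_logsum_diff_rot_le[OF a v ij, of \<theta>] a
        by (simp add: abs_mult G_aq_eq_exp B_def)
    qed
    also have "\<dots> = B * ?Z" by (simp add: Z_aq_def)
    finally show ?thesis .
  qed
  have "\<bar>\<Sum>(i, j) | i < j. dissipation_at (F_aq a q :: real ^ 'n::_ \<Rightarrow> real) i j \<theta>\<bar>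
      \<le> (\<Sum>p\<in>?P. \<bar>dissipation_at (F_aq a q :: real ^ 'n::_ \<Rightarrow> real) (fst p) (snd p) \<theta>\<bar>)"
    using sum_abs[of "\<lambda>p. dissipation_at (F_aq a q :: real ^ 'n::_ \<Rightarrow> real) (fst p) (snd p) \<theta>" ?P]
    by (simp add: split_beta)
  also have "\<dots> \<le> (\<Sum>p\<in>?P. 2 * q * B)"
  proof (rule sum_mono)
    fix p assume "p \<in> ?P"
    then have ij: "fst p \<noteq> snd p" by auto
    have "\<bar>dissipation_at (F_aq a q :: real ^ 'n::_ \<Rightarrow> real) (fst p) (snd p) \<theta>\<bar> \<le> q / ?Z * (2 * B * ?Z)"
      unfolding dissipation_at_F_aq[OF q a ij] abs_mult
      using I[OF ij, of \<theta>] I[OF ij, of "- \<theta>"] Z q0 by (intro mult_mono) (simp, linarith, auto)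
    also have "\<dots> = 2 * q * B" using Z by simp
    finally show "\<bar>dissipation_at (F_aq a q :: real ^ 'n::_ \<Rightarrow> real) (fst p) (snd p) \<theta>\<bar> \<le> 2 * q * B" .
  qed
  also have "\<dots> = real (card ?P) * (4 * q * real CARD('n::_)) * (ln (1/a) + ln (1 + real CARD('n::_)))"
    by (simp add: B_def)
  finally show ?thesis .
qed

section \<open>Fubini and dominated convergence in the angle\<close>

lemma dissipationN_F_aq_eq:
  assumes q: "q > 1/2" and a: "0 < a" "a < 1"
  shows "dissipationN (F_aq a q :: real ^ 'n::{finite,wellorder} \<Rightarrow> real) = 1 / (real CARD('n::_) - 1) *
    (LINT \<theta>|uniform_angle. (\<Sum>(i, j) | i < j. dissipation_at (F_aq a q :: real ^ 'n::_ \<Rightarrow> real) i j \<theta>))"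
proof -
  let ?F = "F_aq a q :: real ^ 'n::_ \<Rightarrow> real" and ?Z = "Z_aq TYPE('n::_) a q"
  let ?S = "sigmaN :: (real ^ 'n::_) measure"
  let ?h = "\<lambda>i j v \<theta>. (?F v - ?F (rot i j \<theta> v)) * (ln (?F v) - ln (?F (rot i j \<theta> v)))"
  interpret S: prob_space ?S by (rule prob_space_sigmaN)
  interpret T: prob_space uniform_angle by (rule prob_space_uniform_angle)
  interpret TS: pair_prob_space ?S uniform_angle ..
  have Z: "?Z > 0" by (rule Z_aq_pos[OF q a])
  have q0: "q > 0" using q by simp
  have sphere [measurable]: "(sphereN :: (real ^ 'n::_) set) \<in> sets borel" by (simp add: sphereN_def)
  have [measurable]: "(\<lambda>(v, \<theta>). ?h i j v \<theta>) \<in> borel_measurable (?S \<Otimes>\<^sub>M uniform_angle)" for i j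
    by measurable
  \<comment> \<open>For fixed \<open>a\<close>, \<open>E / ?Z\<close> bounds the density on the
    sphere; with the bound on the logarithms this makes the integrand bounded almost everywhere on a
    product of probability spaces, which suffices for Fubini.\<close>
  define E where "E = exp (q * (real CARD('n::_) * (ln (1/a) + ln (1 + real CARD('n::_)))))"
  define B where "B = E / ?Z * (q * (2 * (real CARD('n::_) * (ln (1/a) + ln (1 + real CARD('n::_))))))"
  have bound: "\<bar>?h i j v \<theta>\<bar> \<le> B" if v: "v \<in> sphereN" and ij: "i \<noteq> j" for i j v \<theta>
  proof -
    have F: "0 \<le> ?F w \<and> ?F w \<le> E / ?Z" if "w \<in> sphereN" for w
      unfolding F_aq_def E_def using G_aq_le[OF a that q0] a Z
      by (auto simp: G_aq_eq_exp intro!: divide_right_mono)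
    have "\<bar>?F v - ?F (rot i j \<theta> v)\<bar> \<le> E / ?Z"
      using F[OF v] F[OF rot_in_sphereN[OF ij v, of \<theta>]] by linarith
    moreover have "ln (?F v) - ln (?F (rot i j \<theta> v)) = q * (logsum a v - logsum a (rot i j \<theta> v))"
      unfolding ln_F_aq[OF q a] by (simp add: algebra_simps)
    then have "\<bar>ln (?F v) - ln (?F (rot i j \<theta> v))\<bar> \<le> q * (2 * (real CARD('n::_) * (ln (1/a) + ln (1 + real CARD('n::_)))))"
      using abs_logsum_diff_rot_le[OF a v ij, of \<theta>] q0 by (simp add: abs_mult)
    ultimately show ?thesis unfolding B_def abs_mult
      using Z by (intro mult_mono) (auto simp: E_def)
  qed
  have int: "integrable (?S \<Otimes>\<^sub>M uniform_angle) (\<lambda>(v, \<theta>). ?h i j v \<theta>)" if ij: "i \<noteq> j" for i j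
  proof (rule TS.integrable_const_bound[where B = B])
    \<comment> \<open>The measure lives on the whole ambient space while the bound holds only on the
      sphere, so full mass of the sphere is lifted to the product.\<close>
    have "AE p in ?S \<Otimes>\<^sub>M uniform_angle. fst p \<in> sphereN"
    proof (rule TS.AE_pair_measure)
      show "AE v in ?S. AE \<theta> in uniform_angle. fst (v, \<theta>) \<in> sphereN"
        using AE_sigmaN_sphereN by eventually_elim simp
    qed measurable
    then show "AE p in ?S \<Otimes>\<^sub>M uniform_angle. norm (case p of (v, \<theta>) \<Rightarrow> ?h i j v \<theta>) \<le> B"
      by eventually_elim (use bound ij in \<open>auto simp: split_beta\<close>)
  qed measurable
  have pair: "(LINT v|?S. (LINT \<theta>:{0..2 * pi}|lborel. ?h i j v \<theta> / (2 * pi)))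
      = (LINT \<theta>|uniform_angle. dissipation_at ?F i j \<theta>)" if ij: "i \<noteq> j" for i j
  proof -
    have "(LINT v|?S. (LINT \<theta>:{0..2 * pi}|lborel. ?h i j v \<theta> / (2 * pi)))
        = (LINT v|?S. (LINT \<theta>|uniform_angle. ?h i j v \<theta>))"
      by (subst integral_uniform_angle) auto
    also have "\<dots> = (LINT \<theta>|uniform_angle. (LINT v|?S. ?h i j v \<theta>))"
      by (rule TS.Fubini_integral[OF int[OF ij], symmetric])
    finally show ?thesis unfolding dissipation_at_def .
  qed
  have int': "integrable uniform_angle (dissipation_at ?F i j)" if ij: "i \<noteq> j" for i j
    unfolding dissipation_at_def by (rule TS.integrable_snd[OF int[OF ij]])
  have "(\<Sum>(i, j) | i < j. LINT v|?S. (LINT \<theta>:{0..2 * pi}|lborel. ?h i j v \<theta> / (2 * pi)))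
      = (\<Sum>p\<in>{(i, j). i < j}. LINT \<theta>|uniform_angle. dissipation_at ?F (fst p) (snd p) \<theta>)"
  proof (rule sum.cong)
    fix p :: "'n \<times> 'n" assume "p \<in> {(i, j). i < j}"
    then have "fst p \<noteq> snd p" by auto
    from pair[OF this]
    show "(case p of (i, j) \<Rightarrow> LINT v|?S. (LINT \<theta>:{0..2 * pi}|lborel. ?h i j v \<theta> / (2 * pi)))
        = (LINT \<theta>|uniform_angle. dissipation_at ?F (fst p) (snd p) \<theta>)"
      by (simp only: case_prod_beta)
  qed simp
  also have "\<dots> = (LINT \<theta>|uniform_angle. (\<Sum>p\<in>{(i, j). i < j}. dissipation_at ?F (fst p) (snd p) \<theta>))"
    by (rule Bochner_Integration.integral_sum[symmetric]) (auto intro!: int')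
  finally show ?thesis
    unfolding dissipationN_def by (simp add: split_beta)
qed

lemma tendsto_dissipationN_F_aq:
  assumes q: "q > 1/2" and N: "CARD('n::{finite,wellorder}) \<ge> 2"
  shows "((\<lambda>a. dissipationN (F_aq a q :: real ^ 'n::_ \<Rightarrow> real) / ln (1/a)) \<longlongrightarrow> 2 * q) (at_right 0)"
proof -
  let ?N = "real CARD('n::_)"
  interpret T: prob_space uniform_angle by (rule prob_space_uniform_angle)
  define J where "J a \<theta> = (\<Sum>(i, j) | i < j. dissipation_at (F_aq a q :: real ^ 'n::_ \<Rightarrow> real) i j \<theta>)" for a \<theta>
  define C where "C = real (card {(i :: 'n::_, j). i < j}) * (4 * q * ?N)"
  have C: "C \<ge> 0" using q by (simp add: C_def)
  have [measurable]: "J a \<in> borel_measurable borel" for a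
    unfolding J_def split_beta by measurable
  \<comment> \<open>The substitution \<open>a = inverse t\<close> turns the limit at
    \<open>0\<close> from the right into one at infinity, the form that
    \<open>integral_dominated_convergence_at_top\<close> handles.\<close>
  have "((\<lambda>t. LINT \<theta>|uniform_angle. J (inverse t) \<theta> / ln (1 / inverse t))
      \<longlongrightarrow> (LINT \<theta>|uniform_angle. 2 * q * (?N - 1))) at_top"
  proof (rule integral_dominated_convergence_at_top[where w = "\<lambda>_. C * (1 + ln (1 + ?N))"])
    show "AE \<theta> in uniform_angle.
        ((\<lambda>t. J (inverse t) \<theta> / ln (1 / inverse t)) \<longlongrightarrow> 2 * q * (?N - 1)) at_top"
      using AE_uniform_angle_sin_cos
    proof eventually_elim
      case (elim \<theta>)
      obtain K where "\<And>a. 0 < a \<Longrightarrow> a < 1 \<Longrightarrow> \<bar>J a \<theta> - 2 * q * (?N - 1) * ln (1/a)\<bar> \<le> K"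
        unfolding J_def using sum_dissipation_at_asymp[OF q, of \<theta>, where 'n="'n::_"] elim by blast
      then have "((\<lambda>a. J a \<theta> / ln (1/a)) \<longlongrightarrow> 2 * q * (?N - 1)) (at_right 0)"
        by (rule tendsto_div_ln_inverseI)
      then show ?case by (simp add: filterlim_at_right_to_top)
    qed
    show "\<forall>\<^sub>F t in at_top. AE \<theta> in uniform_angle.
        norm (J (inverse t) \<theta> / ln (1 / inverse t)) \<le> C * (1 + ln (1 + ?N))"
      using eventually_ge_at_top[of "exp 1"]
    \<comment> \<open>For \<open>t \<ge> exp 1\<close> one has \<open>ln t \<ge> 1\<close>, so the
      additive constant \<open>ln (1 + ?N)\<close> is absorbed into a multiple of
      \<open>ln t\<close> and the quotient is bounded by a constant.\<close>
    proof (eventually_elim, intro AE_I2)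
      fix t \<theta> :: real assume "exp 1 \<le> t"
      moreover have "1 < exp (1::real)" by simp
      ultimately have t: "1 < t" by linarith
      have l: "ln t \<ge> 1" using \<open>exp 1 \<le> t\<close> t by (simp add: ln_ge_iff)
      have inv: "1 / inverse t = t" by (simp add: divide_inverse)
      have "1 * ln (1 + ?N) \<le> ln t * ln (1 + ?N)" using l by (intro mult_right_mono) auto
      then have lN: "ln t + ln (1 + ?N) \<le> ln t + ln t * ln (1 + ?N)" by simp
      have "\<bar>J (inverse t) \<theta>\<bar> \<le> C * (ln (1 / inverse t) + ln (1 + ?N))"
        unfolding J_def C_def
        by (rule abs_sum_dissipation_at_le[OF q]) (use t in \<open>auto simp: inverse_less_1_iff\<close>)
      also have "\<dots> \<le> C * (ln t + ln t * ln (1 + ?N))"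
        unfolding inv by (rule mult_left_mono[OF lN C])
      also have "\<dots> = C * (1 + ln (1 + ?N)) * ln t" by (simp add: algebra_simps)
      finally show "norm (J (inverse t) \<theta> / ln (1 / inverse t)) \<le> C * (1 + ln (1 + ?N))"
        unfolding inv using l by (simp add: abs_divide pos_divide_le_eq)
    qed
  qed auto
  then have "((\<lambda>a. LINT \<theta>|uniform_angle. J a \<theta> / ln (1 / a)) \<longlongrightarrow> 2 * q * (?N - 1)) (at_right 0)"
    \<comment> \<open>The limiting integrand is constant in the angle, and
      \<open>uniform_angle\<close> has total mass 1.\<close>
    by (simp add: filterlim_at_right_to_top T.prob_space[simplified])
  then have "((\<lambda>a. 1 / (?N - 1) * (LINT \<theta>|uniform_angle. J a \<theta> / ln (1 / a)))
      \<longlongrightarrow> 1 / (?N - 1) * (2 * q * (?N - 1))) (at_right 0)"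
    by (intro tendsto_mult_left)
  \<comment> \<open>Here \<open>N\<close> at least 2 makes \<open>?N - 1\<close> nonzero.\<close>
  also have "1 / (?N - 1) * (2 * q * (?N - 1)) = 2 * q" using N by simp
  finally show ?thesis
  proof (rule Lim_transform_eventually)
    have "\<forall>\<^sub>F a in at_right 0. 0 < a \<and> a < (1::real)"
      by (auto simp: eventually_at_right_field intro: exI[of _ 1])
    then show "\<forall>\<^sub>F a in at_right 0. 1 / (?N - 1) * (LINT \<theta>|uniform_angle. J a \<theta> / ln (1 / a))
        = dissipationN (F_aq a q :: real ^ 'n::_ \<Rightarrow> real) / ln (1/a)"
      by eventually_elim (simp add: dissipationN_F_aq_eq[OF q] J_def)
  qed
qed

theorem proposition1p1:
  fixes q :: real
  assumes "CARD('n::{finite,wellorder}) \<ge> 2" and "q > 1 / 2"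
  shows "((\<lambda>a. entropyN (F_aq a q :: real ^ 'n::_ \<Rightarrow> real) / ln (1 / a))
            \<longlongrightarrow> (real CARD('n::_) - 1) / 2) (at_right 0)
       \<and> ((\<lambda>a. dissipationN (F_aq a q :: real ^ 'n::_ \<Rightarrow> real) / ln (1 / a))
            \<longlongrightarrow> 2 * q) (at_right 0)"
proof
  obtain K where "\<And>a. 0 < a \<Longrightarrow> a < 1 \<Longrightarrow>
    \<bar>entropyN (F_aq a q :: real ^ 'n::_ \<Rightarrow> real) - (real CARD('n::_) - 1) / 2 * ln (1/a)\<bar> \<le> K"
    using entropyN_F_aq_asymp[OF assms(2), where 'n="'n::_"] by blast
  then show "((\<lambda>a. entropyN (F_aq a q :: real ^ 'n::_ \<Rightarrow> real) / ln (1 / a))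
      \<longlongrightarrow> (real CARD('n::_) - 1) / 2) (at_right 0)"
    by (rule tendsto_div_ln_inverseI)
  show "((\<lambda>a. dissipationN (F_aq a q :: real ^ 'n::_ \<Rightarrow> real) / ln (1 / a)) \<longlongrightarrow> 2 * q) (at_right 0)"
    by (rule tendsto_dissipationN_F_aq[OF assms(2,1)])
qed

end
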